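(* Let $E$ be the random Poisson cut-out set in the Heisenberg group $\mathbb{H}$ of intensity parameter $\gamma\in\,]0,4[$ described in the context, and let $\beta=4-\gamma$. Then with positive probability, the Hausdorff dimension of $E$ with respect to the Euclidean metric of $\mathbb{C}\times\mathbb{R}\cong\mathbb{R}^3$ equals $\beta$ if $\beta\le 2$, and equals $2+\frac12(\beta-2)$ if $\beta>2$.
   Context: $\mathbb{H}=\mathbb{C}\times\mathbb{R}$ with group law $(u,s)\cdot(v,t)=(u+v,s+t+\mathrm{Im}(\bar u v))$ and Korányi metric $d(p,q)=\|q^{-1}\cdot p\|$, $\|(u,s)\|=(|u|^4+4s^2)^{1/4}$. Let $\mathcal H$ be Lebesgue measure on $\mathbb{R}^3\cong\mathbb{H}$ normalized so that Korányi balls satisfy $\mathcal H(B(x,r))=r^4$. Let $\{(x_i,r_i)\}$ be a Poisson point process on $\mathbb{H}\times\,]0,1[$ with intensity $\gamma\,\mathcal H\otimes r^{-5}\,\mathrm dr$, let $\Omega$ be the closed unit Korányi ball at $0$, and $E=\Omega\setminus\bigcup_i B(x_i,r_i)$ (Korányi balls). *)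

theory Defs
  imports "HOL-Probability.Probability"
begin

definition heis_mult :: "complex \<times> real \<Rightarrow> complex \<times> real \<Rightarrow> complex \<times> real" where
  "heis_mult p q = (fst p + fst q, snd p + snd q + Im (cnj (fst p) * fst q))"

definition heis_inv :: "complex \<times> real \<Rightarrow> complex \<times> real" where
  "heis_inv p = (- fst p, - snd p)"

definition koranyi_norm :: "complex \<times> real \<Rightarrow> real" where
  "koranyi_norm p = root 4 ((cmod (fst p)) ^ 4 + 4 * (snd p) ^ 2)"

definition koranyi_dist :: "complex \<times> real \<Rightarrow> complex \<times> real \<Rightarrow> real" where
  "koranyi_dist p q = koranyi_norm (heis_mult (heis_inv q) p)"

definition koranyi_ball :: "complex \<times> real \<Rightarrow> real \<Rightarrow> (complex \<times> real) set" where
  "koranyi_ball x r = {p. koranyi_dist p x < r}"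

definition koranyi_cball :: "complex \<times> real \<Rightarrow> real \<Rightarrow> (complex \<times> real) set" where
  "koranyi_cball x r = {p. koranyi_dist p x \<le> r}"

text \<open>Lebesgue measure on R^3 = C x R, normalized so that Koranyi balls B(x,r) have measure r^4
  (normalization constant: reciprocal of the Lebesgue volume of the unit Koranyi ball).\<close>
definition heis_haar :: "(complex \<times> real) measure" where
  "heis_haar = density lborel (\<lambda>_. ennreal (1 / measure lborel (koranyi_ball (0, 0) 1)))"

definition cutout_intensity :: "real \<Rightarrow> ((complex \<times> real) \<times> real) measure" where
  "cutout_intensity \<gamma> = density (heis_haar \<Otimes>\<^sub>M lborel)
      (\<lambda>(x, r). ennreal (\<gamma> * r powr (-5)) * indicator {0<..<1} r)"

definition poisson_point_process :: "'w measure \<Rightarrow> 'b measure \<Rightarrow> ('w \<Rightarrow> 'b set) \<Rightarrow> bool" where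
  "poisson_point_process M \<mu> N \<longleftrightarrow>
     prob_space M \<and>
     (\<forall>\<omega>\<in>space M. N \<omega> \<subseteq> space \<mu>) \<and>
     (\<forall>A\<in>sets \<mu>. emeasure \<mu> A < \<infinity> \<longrightarrow>
        (\<forall>k::nat.
           {\<omega>\<in>space M. finite (N \<omega> \<inter> A) \<and> card (N \<omega> \<inter> A) = k} \<in> sets M \<and>
           measure M {\<omega>\<in>space M. finite (N \<omega> \<inter> A) \<and> card (N \<omega> \<inter> A) = k}
             = exp (- measure \<mu> A) * measure \<mu> A ^ k / fact k)) \<and>
     (\<forall>(F::nat \<Rightarrow> 'b set) n.
        (\<forall>i<n. F i \<in> sets \<mu> \<and> emeasure \<mu> (F i) < \<infinity>) \<and> disjoint_family_on F {..<n} \<longrightarrow>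
        prob_space.indep_vars M (\<lambda>_. count_space UNIV) (\<lambda>i \<omega>. card (N \<omega> \<inter> F i)) {..<n})"

definition cutout_set :: "((complex \<times> real) \<times> real) set \<Rightarrow> (complex \<times> real) set" where
  "cutout_set P = koranyi_cball (0, 0) 1 - (\<Union>(x, r)\<in>P. koranyi_ball x r)"

definition hd_gauge :: "real \<Rightarrow> 'a::metric_space set \<Rightarrow> real" where
  "hd_gauge s U = (if U = {} then 0 else if s = 0 then 1 else diameter U powr s)"

definition hausdorff_premeasure :: "real \<Rightarrow> real \<Rightarrow> 'a::metric_space set \<Rightarrow> ennreal" where
  "hausdorff_premeasure s \<delta> A =
     (INF U \<in> {U :: nat \<Rightarrow> 'a set. A \<subseteq> (\<Union>i. U i) \<and> (\<forall>i. bounded (U i) \<and> diameter (U i) \<le> \<delta>)}.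
        (\<Sum>i. ennreal (hd_gauge s (U i))))"

definition hausdorff_measure :: "real \<Rightarrow> 'a::metric_space set \<Rightarrow> ennreal" where
  "hausdorff_measure s A = (SUP \<delta> \<in> {0<..}. hausdorff_premeasure s \<delta> A)"

definition hausdorff_dim :: "'a::metric_space set \<Rightarrow> real" where
  "hausdorff_dim A = Inf {s. 0 \<le> s \<and> hausdorff_measure s A = 0}"

end

theory Submission
  imports Defs
begin

text \<open>Only void probabilities of the Poisson process enter. A point of \<open>\<Omega>\<close> is missed by all balls of radius
  larger than \<open>e\<close> with probability \<open>e\<^sup>\<gamma>\<close>, and a Koranyi ball of radius \<open>e\<close> is not swallowed by one of them with
  probability \<open>O(e\<^sup>\<gamma>)\<close>. Covering \<open>\<Omega>\<close> by \<open>e\<^sup>-\<^sup>4\<close> sheared cells of Euclidean diameter \<open>O(e)\<close>, or by \<open>e\<^sup>-\<^sup>6\<close> cubes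
  of side \<open>e\<^sup>2\<close>, all of them inside Koranyi balls of radius \<open>O(e)\<close>, bounds the dimension almost surely by
  \<open>4 - \<gamma>\<close> and by \<open>(6 - \<gamma>)/2\<close>.

  Conversely two points at Koranyi distance \<open>d\<close> are both missed with probability at most
  \<open>e\<^sup>2\<^sup>\<gamma> (2/d)\<^sup>\<gamma>\<close>, so the normalized Lebesgue measures on the sets missed at level \<open>e\<close> have bounded expected
  energy for the Euclidean Riesz kernel of every order below the minimum of the two bounds. By a second moment
  argument mass and energy are simultaneously under control infinitely often with positive probability;
  since an open cover of the compact limit set already covers some finite level, no limit measure is needed.\<close>

section \<open>Geometry of the Koranyi norm\<close>

text \<open>The dimension has two regimes because the two metrics disagree in the vertical
  direction: at height difference t the Koranyi distance is of order |t|^(1/2), the Euclidean one of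
  order |t|. A Koranyi ball of radius e is a sheared slab of size e, e, e^2. It can be used whole,
  as one set of diameter O(e), or be cut into about e^-2 cubes of side e^2; the cheaper choice
  changes at \<open>\<gamma> = 2\<close>, that is \<beta> = 2. In the energy the same competition
  appears as a choice of how much of each kernel is charged to the vertical variable. Two obstacles
  shape the lower bound. An event of positive probability found separately for each exponent s could
  shrink as s approaches the critical value, so a single kernel has to dominate a whole sequence of
  Riesz kernels and yield one event. Moreover, neither hitting a cell nor the dimension of the
  random set is known to be measurable, so every event is built from void events, and an almost sure
  exceptional set is removed only at the end.\<close>

lemma koranyi_norm_eq: "koranyi_norm p = sqrt (cmod (Complex ((cmod (fst p))\<^sup>2) (2 * snd p)))"
proof -
  have "koranyi_norm p = root (2*2) ((cmod (fst p)) ^ 4 + 4 * (snd p) ^ 2)"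
    by (simp add: koranyi_norm_def)
  also have "\<dots> = sqrt (sqrt ((cmod (fst p)) ^ 4 + 4 * (snd p) ^ 2))"
    by (simp only: real_root_mult_exp sqrt_def)
  also have "(cmod (fst p)) ^ 4 + 4 * (snd p) ^ 2 = ((cmod (fst p))\<^sup>2)\<^sup>2 + (2 * snd p)\<^sup>2"
    by (simp add: power_mult_distrib)
  finally show ?thesis by (simp add: cmod_def)
qed

lemma koranyi_norm_nonneg [simp]: "0 \<le> koranyi_norm p"
  by (simp add: koranyi_norm_eq)

lemma koranyi_norm_power2: "(koranyi_norm p)\<^sup>2 = cmod (Complex ((cmod (fst p))\<^sup>2) (2 * snd p))"
  by (simp add: koranyi_norm_eq)

lemma koranyi_norm_power4: "(koranyi_norm p)^4 = (cmod (fst p))^4 + 4 * (snd p)\<^sup>2"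
  by (simp add: koranyi_norm_def)

lemma koranyi_norm_zero [simp]: "koranyi_norm (0, 0) = 0"
  by (simp add: koranyi_norm_def)

lemma koranyi_norm_inv [simp]: "koranyi_norm (heis_inv p) = koranyi_norm p"
  by (simp add: koranyi_norm_def heis_inv_def)

lemma cmod_fst_le_koranyi_norm: "cmod (fst p) \<le> koranyi_norm p"
proof -
  have "(cmod (fst p))^4 \<le> (koranyi_norm p)^4"
    by (simp add: koranyi_norm_power4)
  then show ?thesis
    using power_mono_iff[of "cmod (fst p)" "koranyi_norm p" 4] by simp
qed

lemma snd_le_koranyi_norm: "\<bar>snd p\<bar> \<le> (koranyi_norm p)\<^sup>2 / 2"
proof -
  have "\<bar>2 * snd p\<bar> \<le> (koranyi_norm p)\<^sup>2"
    unfolding koranyi_norm_power2 using abs_Im_le_cmod[of "Complex ((cmod (fst p))\<^sup>2) (2 * snd p)"] by simp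
  then show ?thesis by (simp add: abs_mult)
qed

text \<open>Turns separate bounds on the two coordinates into a Koranyi radius; the height enters
  through its square root.\<close>

lemma koranyi_norm_le: "koranyi_norm p \<le> cmod (fst p) + sqrt (2 * \<bar>snd p\<bar>)"
proof -
  have "(koranyi_norm p)\<^sup>2 \<le> (cmod (fst p))\<^sup>2 + 2 * \<bar>snd p\<bar>"
    unfolding koranyi_norm_power2
    using cmod_le[of "Complex ((cmod (fst p))\<^sup>2) (2 * snd p)"] by (simp add: abs_mult)
  also have "\<dots> \<le> (cmod (fst p) + sqrt (2 * \<bar>snd p\<bar>))\<^sup>2"
    by (simp add: power2_sum)
  finally show ?thesis
    by (rule power2_le_imp_le) simp
qed

text \<open>The squared norm is the modulus of \<open>|u|\<^sup>2 + 2is\<close>, and these complex numbers add up under the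
  group law with the correction \<open>2 \<langle>u, v\<rangle>\<close>, whose modulus is \<open>2|u||v|\<close>.\<close>
lemma koranyi_norm_mult_le: "koranyi_norm (heis_mult p q) \<le> koranyi_norm p + koranyi_norm q"
proof -
  let ?c = "\<lambda>p. Complex ((cmod (fst p))\<^sup>2) (2 * snd p)"
  have "?c (heis_mult p q) = ?c p + ?c q + 2 * (cnj (fst p) * fst q)"
    by (rule complex_eqI) (simp_all add: heis_mult_def cmod_power2 power2_sum algebra_simps)
  then have "cmod (?c (heis_mult p q)) \<le> cmod (?c p + ?c q) + cmod (2 * (cnj (fst p) * fst q))"
    by (metis norm_triangle_ineq)
  also have "\<dots> \<le> cmod (?c p) + cmod (?c q) + 2 * (cmod (fst p) * cmod (fst q))"
    by (simp add: norm_mult norm_triangle_ineq)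
  finally have "(koranyi_norm (heis_mult p q))\<^sup>2
      \<le> (koranyi_norm p)\<^sup>2 + (koranyi_norm q)\<^sup>2 + 2 * (cmod (fst p) * cmod (fst q))"
    by (simp only: koranyi_norm_power2)
  also have "\<dots> \<le> (koranyi_norm p)\<^sup>2 + (koranyi_norm q)\<^sup>2 + 2 * (koranyi_norm p * koranyi_norm q)"
    by (intro add_left_mono mult_left_mono mult_mono cmod_fst_le_koranyi_norm) auto
  also have "\<dots> = (koranyi_norm p + koranyi_norm q)\<^sup>2"
    by (simp add: power2_sum)
  finally show ?thesis
    by (rule power2_le_imp_le) simp
qed

lemma heis_inv_inv [simp]: "heis_inv (heis_inv p) = p"
  by (simp add: heis_inv_def)

lemma heis_mult_assoc: "heis_mult (heis_mult p q) r = heis_mult p (heis_mult q r)"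
  by (simp add: heis_mult_def algebra_simps)

lemma heis_mult_inv_left [simp]: "heis_mult (heis_inv p) (heis_mult p q) = q"
  by (simp add: heis_mult_def heis_inv_def algebra_simps prod_eq_iff)

lemma heis_mult_inv_right [simp]: "heis_mult p (heis_mult (heis_inv p) q) = q"
  by (metis heis_mult_inv_left heis_inv_inv)

lemma heis_inv_mult: "heis_inv (heis_mult p q) = heis_mult (heis_inv q) (heis_inv p)"
  by (simp add: heis_mult_def heis_inv_def algebra_simps)

lemma koranyi_dist_nonneg [simp]: "0 \<le> koranyi_dist p q"
  by (simp add: koranyi_dist_def)

lemma koranyi_dist_sym: "koranyi_dist p q = koranyi_dist q p"
  by (metis koranyi_dist_def koranyi_norm_inv heis_inv_mult heis_inv_inv)

lemma koranyi_dist_triangle: "koranyi_dist p r \<le> koranyi_dist p q + koranyi_dist q r"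
  using koranyi_norm_mult_le[of "heis_mult (heis_inv r) q" "heis_mult (heis_inv q) p"]
  by (simp add: koranyi_dist_def heis_mult_assoc)

lemma koranyi_dist_mult_left [simp]: "koranyi_dist (heis_mult x p) x = koranyi_norm p"
  by (simp add: koranyi_dist_def)

lemma koranyi_dist_mult_right [simp]: "koranyi_dist x (heis_mult x p) = koranyi_norm p"
  by (metis koranyi_dist_sym koranyi_dist_mult_left)

lemma koranyi_dist_self [simp]: "koranyi_dist p p = 0"
  by (simp add: koranyi_dist_def heis_mult_def heis_inv_def)

lemma koranyi_dist_zero [simp]: "koranyi_dist p (0, 0) = koranyi_norm p"
  by (simp add: koranyi_dist_def heis_mult_def heis_inv_def)

lemma koranyi_dist_zero2 [simp]: "koranyi_dist (0, 0) p = koranyi_norm p"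
  using koranyi_dist_sym koranyi_dist_zero by metis

lemma continuous_on_heis_mult [continuous_intros]:
  "continuous_on S f \<Longrightarrow> continuous_on S g \<Longrightarrow> continuous_on S (\<lambda>x. heis_mult (f x) (g x))"
  unfolding heis_mult_def by (intro continuous_intros)

lemma continuous_on_koranyi_norm [continuous_intros]:
  "continuous_on S f \<Longrightarrow> continuous_on S (\<lambda>x. koranyi_norm (f x))"
  unfolding koranyi_norm_def by (intro continuous_intros)

lemma continuous_on_koranyi_dist [continuous_intros]:
  "continuous_on S f \<Longrightarrow> continuous_on S g \<Longrightarrow> continuous_on S (\<lambda>x. koranyi_dist (f x) (g x))"
  unfolding koranyi_dist_def heis_inv_def by (intro continuous_intros)

lemma borel_measurable_koranyi_dist [measurable]:
  assumes [measurable]: "f \<in> borel_measurable A" "g \<in> borel_measurable A"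
  shows "(\<lambda>x. koranyi_dist (f x) (g x)) \<in> borel_measurable A"
proof -
  have "(\<lambda>p. koranyi_dist (fst p) (snd p)) \<in> borel_measurable borel"
    by (intro borel_measurable_continuous_onI continuous_intros)
  then have "(\<lambda>x. koranyi_dist (fst (f x, g x)) (snd (f x, g x))) \<in> borel_measurable A"
    by (rule measurable_compose_rev) measurable
  then show ?thesis by simp
qed

lemma borel_measurable_koranyi_norm [measurable]:
  assumes [measurable]: "f \<in> borel_measurable A"
  shows "(\<lambda>x. koranyi_norm (f x)) \<in> borel_measurable A"
proof -
  have "(\<lambda>x. koranyi_dist (f x) (0, 0)) \<in> borel_measurable A"
    by measurable
  then show ?thesis by simp
qed

lemma borel_measurable_heis_mult [measurable]: "heis_mult x \<in> borel_measurable borel"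
  by (intro borel_measurable_continuous_onI continuous_intros)

lemma open_koranyi_ball [simp]: "open (koranyi_ball x r)"
  unfolding koranyi_ball_def by (intro open_Collect_less continuous_intros)

lemma closed_koranyi_cball [simp]: "closed (koranyi_cball x r)"
  unfolding koranyi_cball_def by (intro closed_Collect_le continuous_intros)

lemma norm_le_of_koranyi_norm_le:
  assumes "koranyi_norm p \<le> 1"
  shows "norm p \<le> 2"
proof -
  have "(koranyi_norm p)\<^sup>2 \<le> 1" using assms by (simp add: power_le_one)
  then have "cmod (fst p) \<le> 1" "\<bar>snd p\<bar> \<le> 1"
    using cmod_fst_le_koranyi_norm[of p] snd_le_koranyi_norm[of p] assms by auto
  moreover have "norm p \<le> cmod (fst p) + \<bar>snd p\<bar>"
    using norm_Pair_le[of "fst p" "snd p"] by simp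
  ultimately show ?thesis by simp
qed

lemma compact_koranyi_unit_cball: "compact (koranyi_cball (0, 0) 1)"
proof -
  have "bounded (koranyi_cball (0, 0) 1)"
    unfolding bounded_iff koranyi_cball_def using norm_le_of_koranyi_norm_le by auto
  then show ?thesis by (simp add: compact_eq_bounded_closed)
qed

text \<open>In the coordinates centred at \<open>x\<close> the Euclidean distance is, up to a constant, at least the
  Euclidean norm, since the shear is bounded on the unit ball.\<close>
lemma dist_heis_mult_ge:
  assumes "cmod (fst x) \<le> 1"
  shows "cmod (fst p) \<le> 2 * dist x (heis_mult x p)" "\<bar>snd p\<bar> \<le> 2 * dist x (heis_mult x p)"
proof -
  let ?w = "snd p + Im (cnj (fst x) * fst p)"
  have "x - heis_mult x p = - (fst p, ?w)"
    by (simp add: heis_mult_def minus_prod_def uminus_prod_def prod_eq_iff)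
  then have d: "dist x (heis_mult x p) = norm (fst p, ?w)"
    by (simp only: dist_norm norm_minus_cancel)
  have 1: "cmod (fst p) \<le> dist x (heis_mult x p)" and 2: "\<bar>?w\<bar> \<le> dist x (heis_mult x p)"
    unfolding d using norm_fst_le[of "fst p" ?w] norm_snd_le[of ?w "fst p"]
    by (simp_all only: real_norm_def)
  have "\<bar>Im (cnj (fst x) * fst p)\<bar> \<le> cmod (fst x) * cmod (fst p)"
    using abs_Im_le_cmod[of "cnj (fst x) * fst p"] by (simp add: norm_mult)
  also have "\<dots> \<le> 1 * cmod (fst p)"
    using assms by (intro mult_right_mono) auto
  finally have "\<bar>snd p\<bar> \<le> \<bar>?w\<bar> + cmod (fst p)" by linarith
  then show "\<bar>snd p\<bar> \<le> 2 * dist x (heis_mult x p)" using 1 2 by linarith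
  show "cmod (fst p) \<le> 2 * dist x (heis_mult x p)" using 1 zero_le_dist[of x "heis_mult x p"] by linarith
qed

section \<open>Lebesgue measure on the Heisenberg group\<close>

lemma borel_measurable_Complex [measurable]:
  assumes [measurable]: "f \<in> borel_measurable M" "g \<in> borel_measurable M"
  shows "(\<lambda>x. Complex (f x) (g x)) \<in> borel_measurable M"
  unfolding Complex_eq by measurable

text \<open>Both measures agree on boxes, since the basis of the complex plane consists of 1 and the
  imaginary unit. This gives access to iterated integrals over real and imaginary parts.\<close>

lemma lborel_complex_eq:
  "(lborel :: complex measure) = distr (lborel \<Otimes>\<^sub>M lborel) borel (\<lambda>(x, y). Complex x y)"
proof (rule lborel_eqI)
  have [measurable]: "(\<lambda>(x, y). Complex x y) \<in> borel_measurable (lborel \<Otimes>\<^sub>M lborel)"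
    by measurable
  show "sets (distr (lborel \<Otimes>\<^sub>M lborel) borel (\<lambda>(x, y). Complex x y)) = sets borel" by simp
  fix l u :: complex assume le: "\<And>b. b \<in> Basis \<Longrightarrow> l \<bullet> b \<le> u \<bullet> b"
  have "l \<bullet> 1 \<le> u \<bullet> 1" "l \<bullet> \<i> \<le> u \<bullet> \<i>"
    by (intro le; simp add: Basis_complex_def)+
  then have lu: "Re l \<le> Re u" "Im l \<le> Im u" by auto
  have "(\<lambda>(x, y). Complex x y) -` box l u \<inter> space (lborel \<Otimes>\<^sub>M lborel) = {Re l<..<Re u} \<times> {Im l<..<Im u}"
    by (auto simp: box_def Basis_complex_def space_pair_measure)
  then show "emeasure (distr (lborel \<Otimes>\<^sub>M lborel) borel (\<lambda>(x, y). Complex x y)) (box l u)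
      = (\<Prod>b\<in>Basis. (u - l) \<bullet> b)"
    using lu by (simp add: emeasure_distr lborel.emeasure_pair_measure_Times Basis_complex_def
        ennreal_mult'[symmetric])
qed

lemma nn_integral_lborel_complex:
  fixes f :: "complex \<Rightarrow> ennreal"
  assumes [measurable]: "f \<in> borel_measurable borel"
  shows "(\<integral>\<^sup>+z. f z \<partial>lborel) = (\<integral>\<^sup>+x. \<integral>\<^sup>+y. f (Complex x y) \<partial>lborel \<partial>lborel)"
proof -
  have [measurable]: "(\<lambda>(x, y). Complex x y) \<in> borel_measurable (lborel \<Otimes>\<^sub>M lborel)"
    by measurable
  have [measurable]: "(\<lambda>p. f (case p of (x, y) \<Rightarrow> Complex x y)) \<in> borel_measurable (lborel \<Otimes>\<^sub>M lborel)"
    by measurable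
  show ?thesis
    by (subst lborel_complex_eq, subst nn_integral_distr)
      (simp_all add: lborel.nn_integral_fst[symmetric])
qed

lemma nn_integral_lborel_prod:
  fixes f :: "'a::euclidean_space \<times> 'b::euclidean_space \<Rightarrow> ennreal"
  assumes [measurable]: "f \<in> borel_measurable borel"
  shows "(\<integral>\<^sup>+p. f p \<partial>lborel) = (\<integral>\<^sup>+x. \<integral>\<^sup>+y. f (x, y) \<partial>lborel \<partial>lborel)"
proof -
  have [measurable]: "f \<in> borel_measurable (lborel \<Otimes>\<^sub>M lborel)"
    using assms by (simp add: lborel_prod)
  show ?thesis
    by (subst lborel_prod[symmetric], subst lborel.nn_integral_fst[symmetric]) simp_all
qed

lemma nn_integral_lborel_translate:
  fixes f :: "'a::euclidean_space \<Rightarrow> ennreal"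
  assumes [measurable]: "f \<in> borel_measurable borel"
  shows "(\<integral>\<^sup>+x. f (a + x) \<partial>lborel) = (\<integral>\<^sup>+x. f x \<partial>lborel)"
  by (subst (2) lborel_distr_plus[of a, symmetric], subst nn_integral_distr) simp_all

text \<open>For a fixed horizontal coordinate a left translation merely shifts the height, so
  integrating the height first removes the shear; what remains is a translation of the
  plane.\<close>

lemma nn_integral_heis_translate:
  fixes f :: "complex \<times> real \<Rightarrow> ennreal"
  assumes [measurable]: "f \<in> borel_measurable borel"
  shows "(\<integral>\<^sup>+p. f (heis_mult x p) \<partial>lborel) = (\<integral>\<^sup>+p. f p \<partial>lborel)"
proof -
  have [measurable]: "f \<in> borel_measurable (borel \<Otimes>\<^sub>M borel)"
    by (simp add: borel_prod)
  have "(\<integral>\<^sup>+p. f (heis_mult x p) \<partial>lborel)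
      = (\<integral>\<^sup>+v. \<integral>\<^sup>+t. f (heis_mult x (v, t)) \<partial>lborel \<partial>lborel)"
    by (rule nn_integral_lborel_prod) measurable
  also have "\<dots> = (\<integral>\<^sup>+v. \<integral>\<^sup>+t. f (fst x + v, (snd x + Im (cnj (fst x) * v)) + t) \<partial>lborel \<partial>lborel)"
    by (simp add: heis_mult_def algebra_simps)
  also have "\<dots> = (\<integral>\<^sup>+v. \<integral>\<^sup>+t. f (fst x + v, t) \<partial>lborel \<partial>lborel)"
    by (intro nn_integral_cong nn_integral_lborel_translate) measurable
  also have "\<dots> = (\<integral>\<^sup>+v. \<integral>\<^sup>+t. f (v, t) \<partial>lborel \<partial>lborel)"
    by (rule nn_integral_lborel_translate[where f = "\<lambda>v. \<integral>\<^sup>+t. f (v, t) \<partial>lborel"]) measurable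
  also have "\<dots> = (\<integral>\<^sup>+p. f p \<partial>lborel)"
    by (rule nn_integral_lborel_prod[symmetric]) simp
  finally show ?thesis .
qed

lemma sets_koranyi_ball [measurable]: "koranyi_ball x r \<in> sets borel"
  by (intro borel_open open_koranyi_ball)

lemma nn_integral_lborel_scale_complex:
  fixes f :: "complex \<Rightarrow> ennreal"
  assumes [measurable]: "f \<in> borel_measurable borel" and "0 < r"
  shows "(\<integral>\<^sup>+z. f z \<partial>lborel) = ennreal (r\<^sup>2) * (\<integral>\<^sup>+z. f (of_real r * z) \<partial>lborel)"
proof -
  have C: "Complex (r * x) (r * y) = of_real r * Complex x y" for x y
    by (simp add: complex_eq_iff)
  have "(\<integral>\<^sup>+z. f z \<partial>lborel) = ennreal r * (\<integral>\<^sup>+x. \<integral>\<^sup>+y. f (Complex (r * x) y) \<partial>lborel \<partial>lborel)"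
    using nn_integral_real_affine[of "\<lambda>x. \<integral>\<^sup>+y. f (Complex x y) \<partial>lborel" r 0] \<open>0 < r\<close>
    by (simp add: nn_integral_lborel_complex)
  also have "\<dots> = ennreal r * (\<integral>\<^sup>+x. ennreal r * (\<integral>\<^sup>+y. f (Complex (r * x) (r * y)) \<partial>lborel) \<partial>lborel)"
    using nn_integral_real_affine[of "\<lambda>y. f (Complex (r * x) y)" r 0 for x] \<open>0 < r\<close>
    by simp
  also have "\<dots> = ennreal (r\<^sup>2) * (\<integral>\<^sup>+x. \<integral>\<^sup>+y. f (Complex (r * x) (r * y)) \<partial>lborel \<partial>lborel)"
    using \<open>0 < r\<close> by (simp add: nn_integral_cmult mult.assoc[symmetric] ennreal_mult'[symmetric] power2_eq_square)
  also have "\<dots> = ennreal (r\<^sup>2) * (\<integral>\<^sup>+z. f (of_real r * z) \<partial>lborel)"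
    by (simp add: C nn_integral_lborel_complex)
  finally show ?thesis .
qed

lemma koranyi_norm_dilation:
  assumes "0 \<le> r"
  shows "koranyi_norm (of_real r * u, r\<^sup>2 * t) = r * koranyi_norm (u, t)"
proof -
  have "(koranyi_norm (of_real r * u, r\<^sup>2 * t))^4 = (r * koranyi_norm (u, t))^4"
    by (simp add: koranyi_norm_power4 norm_mult power_mult_distrib algebra_simps)
  then show ?thesis
    using assms by (metis koranyi_norm_nonneg mult_nonneg_nonneg power_eq_iff_eq_base zero_less_numeral)
qed

text \<open>Translation invariance moves the centre to the origin. The dilation (r u, r^2 t), under
  which the norm is homogeneous, then has Jacobian r^2 from the plane times r^2 from the
  height.\<close>

lemma emeasure_koranyi_ball:
  assumes "0 < r"
  shows "emeasure lborel (koranyi_ball x r) = ennreal (r^4) * emeasure lborel (koranyi_ball (0, 0) 1)"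
proof -
  let ?I = "\<lambda>r p. indicator {p. koranyi_norm p < r} p :: ennreal"
  have [measurable]: "?I r \<in> borel_measurable borel" for r
    by measurable
  have [measurable]: "?I r \<in> borel_measurable (borel \<Otimes>\<^sub>M borel)" for r
    by (simp add: borel_prod)
  have "emeasure lborel (koranyi_ball x r) = (\<integral>\<^sup>+p. indicator (koranyi_ball x r) p \<partial>lborel)"
    by simp
  also have "\<dots> = (\<integral>\<^sup>+p. indicator (koranyi_ball x r) (heis_mult x p) \<partial>lborel)"
    by (rule nn_integral_heis_translate[symmetric]) simp
  also have "\<dots> = (\<integral>\<^sup>+p. ?I r p \<partial>lborel)"
    by (simp add: koranyi_ball_def indicator_def)
  also have "\<dots> = (\<integral>\<^sup>+u. \<integral>\<^sup>+t. ?I r (u, t) \<partial>lborel \<partial>lborel)"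
    by (rule nn_integral_lborel_prod) measurable
  also have "\<dots> = ennreal (r\<^sup>2) * (\<integral>\<^sup>+u. \<integral>\<^sup>+t. ?I r (of_real r * u, t) \<partial>lborel \<partial>lborel)"
    using assms by (intro nn_integral_lborel_scale_complex) measurable
  also have "\<dots> = ennreal (r\<^sup>2) * (\<integral>\<^sup>+u. ennreal (r\<^sup>2) * (\<integral>\<^sup>+t. ?I r (of_real r * u, r\<^sup>2 * t) \<partial>lborel) \<partial>lborel)"
    using nn_integral_real_affine[of "\<lambda>t. ?I r (of_real r * u, t)" "r\<^sup>2" 0 for u] assms by simp
  also have "\<dots> = ennreal (r^4) * (\<integral>\<^sup>+u. \<integral>\<^sup>+t. ?I r (of_real r * u, r\<^sup>2 * t) \<partial>lborel \<partial>lborel)"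
    by (subst nn_integral_cmult) (simp_all add: mult.assoc[symmetric] ennreal_mult'[symmetric])
  also have "(\<lambda>u t. ?I r (of_real r * u, r\<^sup>2 * t)) = (\<lambda>u t. ?I 1 (u, t))"
    using assms by (intro ext) (simp add: koranyi_norm_dilation indicator_def)
  also have "(\<integral>\<^sup>+u. \<integral>\<^sup>+t. ?I 1 (u, t) \<partial>lborel \<partial>lborel) = (\<integral>\<^sup>+p. ?I 1 p \<partial>lborel)"
    by (rule nn_integral_lborel_prod[symmetric]) measurable
  also have "\<dots> = (\<integral>\<^sup>+p. indicator (koranyi_ball (0, 0) 1) p \<partial>lborel)"
    by (simp add: koranyi_ball_def)
  finally show ?thesis by simp
qed

lemma koranyi_ball_subset_cball: "koranyi_ball x r \<subseteq> koranyi_cball x r"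
  by (auto simp: koranyi_ball_def koranyi_cball_def)

text \<open>Both halves make the normalization of \<open>heis_haar\<close> meaningful:
  \<open>measure\<close> returns 0 on sets of infinite measure, and a reciprocal of 0 would be
  0.\<close>

lemma emeasure_koranyi_unit_ball:
  "0 < emeasure lborel (koranyi_ball (0, 0) 1)" "emeasure lborel (koranyi_ball (0, 0) 1) < \<infinity>"
proof -
  have "(0, 0) \<in> koranyi_ball (0, 0) 1" by (simp add: koranyi_ball_def)
  then have "\<not> negligible (koranyi_ball (0, 0) 1)"
    by (intro open_not_negligible open_koranyi_ball) (metis empty_iff)
  then have "koranyi_ball (0, 0) 1 \<notin> null_sets lborel"
    unfolding negligible_iff_null_sets by (metis null_sets_completionI)
  then have "emeasure lborel (koranyi_ball (0, 0) 1) \<noteq> 0"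
    by (metis null_setsI sets_koranyi_ball sets_lborel)
  then show "0 < emeasure lborel (koranyi_ball (0, 0) 1)"
    by (metis not_gr_zero)
  have "bounded (koranyi_ball (0, 0) 1)"
    by (rule bounded_subset[OF compact_imp_bounded[OF compact_koranyi_unit_cball] koranyi_ball_subset_cball])
  then show "emeasure lborel (koranyi_ball (0, 0) 1) < \<infinity>"
    by (rule emeasure_bounded_finite)
qed

lemma emeasure_heis_haar_koranyi_ball:
  assumes "0 \<le> r"
  shows "emeasure heis_haar (koranyi_ball x r) = ennreal (r^4)"
proof (cases "r = 0")
  case True
  then have "koranyi_ball x r = {}" by (auto simp: koranyi_ball_def not_less)
  with True show ?thesis by simp
next
  case False
  define V where "V = measure lborel (koranyi_ball (0::complex, 0::real) 1)"
  have V: "emeasure lborel (koranyi_ball (0::complex, 0::real) 1) = ennreal V"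
    unfolding V_def using emeasure_koranyi_unit_ball(2)
    by (intro emeasure_eq_ennreal_measure) (metis infinity_ennreal_def less_irrefl)
  then have "0 < V" using emeasure_koranyi_unit_ball by (metis ennreal_less_zero_iff)
  have "emeasure heis_haar (koranyi_ball x r) = ennreal (1 / V) * emeasure lborel (koranyi_ball x r)"
    unfolding heis_haar_def V_def by (simp add: emeasure_density nn_integral_cmult)
  also have "\<dots> = ennreal (1 / V) * (ennreal (r^4) * ennreal V)"
    using False assms emeasure_koranyi_ball[of r x] V by simp
  also have "\<dots> = ennreal (1 / V * (r^4 * V))"
    using \<open>0 < V\<close> by (metis ennreal_mult' ennreal_mult'' less_imp_le mult.commute zero_le_divide_1_iff)
  also have "1 / V * (r^4 * V) = r^4" using \<open>0 < V\<close> by simp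
  finally show ?thesis .
qed

lemma sets_heis_haar [measurable_cong, simp]: "sets heis_haar = sets borel"
  by (simp add: heis_haar_def)

lemma space_heis_haar [simp]: "space heis_haar = UNIV"
  by (simp add: heis_haar_def)

lemma sigma_finite_heis_haar: "sigma_finite_measure heis_haar"
  unfolding heis_haar_def
  by (rule sigma_finite_measure.sigma_finite_iff_density_finite'[OF sigma_finite_lborel, THEN iffD2]) simp_all

section \<open>The intensity of covering balls\<close>

text \<open>The balls \<open>B(z, r)\<close> with \<open>r > e\<close> that contain the ball of radius \<open>\<rho>\<close> about \<open>x\<close>; for \<open>\<rho> = 0\<close>, those
  that cover \<open>x\<close>.\<close>
definition shadow :: "complex \<times> real \<Rightarrow> real \<Rightarrow> real \<Rightarrow> ((complex \<times> real) \<times> real) set" where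
  "shadow x \<rho> e = {p. e < snd p \<and> koranyi_dist x (fst p) < snd p - \<rho>}"

lemma open_shadow: "open (shadow x \<rho> e)"
  unfolding shadow_def by (intro open_Collect_conj open_Collect_less continuous_intros)

lemma sets_shadow [measurable, simp]: "shadow x \<rho> e \<in> sets borel"
  by (intro borel_open open_shadow)

lemma sets_cutout_intensity [measurable_cong, simp]: "sets (cutout_intensity \<gamma>) = sets borel"
proof -
  have "sets (cutout_intensity \<gamma>) = sets (heis_haar \<Otimes>\<^sub>M lborel)"
    by (simp add: cutout_intensity_def)
  also have "\<dots> = sets (borel \<Otimes>\<^sub>M borel)"
    by (intro sets_pair_measure_cong) simp_all
  also have "\<dots> = sets borel"
    by (simp only: borel_prod)
  finally show ?thesis .
qed

lemma space_cutout_intensity [simp]: "space (cutout_intensity \<gamma>) = UNIV"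
  using sets_eq_imp_space_eq[OF sets_cutout_intensity, of \<gamma>] by simp

text \<open>Integrating over the centre first, at a fixed radius r the admissible centres form a
  Koranyi ball of radius \<open>r - \<rho>\<close>, which has normalized volume (r -
  \<rho>)^4.\<close>

lemma emeasure_shadow:
  assumes "0 \<le> \<rho>" "\<rho> \<le> e" "0 < e" "0 \<le> \<gamma>"
  shows "emeasure (cutout_intensity \<gamma>) (shadow x \<rho> e)
    = (\<integral>\<^sup>+r. ennreal (\<gamma> * ((r - \<rho>)^4 / r^5)) * indicator {e<..<1} r \<partial>lborel)"
proof -
  interpret H: sigma_finite_measure heis_haar by (rule sigma_finite_heis_haar)
  interpret P: pair_sigma_finite heis_haar lborel ..
  let ?g = "\<lambda>r. ennreal (\<gamma> * r powr (-5)) * indicator {0<..<1} r"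
  have sets_eq: "sets (heis_haar \<Otimes>\<^sub>M (lborel :: real measure)) = sets borel"
    using sets_cutout_intensity[of \<gamma>] unfolding cutout_intensity_def sets_density .
  have sh [measurable]: "shadow x \<rho> e \<in> sets (heis_haar \<Otimes>\<^sub>M lborel)"
    unfolding sets_eq by (rule sets_shadow)
  have "emeasure (cutout_intensity \<gamma>) (shadow x \<rho> e)
      = (\<integral>\<^sup>+(z, r). ?g r * indicator (shadow x \<rho> e) (z, r) \<partial>(heis_haar \<Otimes>\<^sub>M lborel))"
    unfolding cutout_intensity_def
  proof (subst emeasure_density)
    show "(\<lambda>(x, r). ?g r) \<in> borel_measurable (heis_haar \<Otimes>\<^sub>M lborel)"
      by measurable
  qed (rule sh, auto intro!: nn_integral_cong simp: case_prod_beta)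
  also have "\<dots> = (\<integral>\<^sup>+r. \<integral>\<^sup>+z. ?g r * indicator (shadow x \<rho> e) (z, r) \<partial>heis_haar \<partial>lborel)"
  proof (subst P.nn_integral_snd[symmetric])
    show "(\<lambda>(z, r). ?g r * indicator (shadow x \<rho> e) (z, r)) \<in> borel_measurable (heis_haar \<Otimes>\<^sub>M lborel)"
      using sh by measurable
  qed simp
  also have "\<dots> = (\<integral>\<^sup>+r. ennreal (\<gamma> * ((r - \<rho>)^4 / r^5)) * indicator {e<..<1} r \<partial>lborel)"
  proof (intro nn_integral_cong)
    fix r :: real
    show "(\<integral>\<^sup>+z. ?g r * indicator (shadow x \<rho> e) (z, r) \<partial>heis_haar)
        = ennreal (\<gamma> * ((r - \<rho>)^4 / r^5)) * indicator {e<..<1} r"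
    proof (cases "e < r \<and> r < 1")
      case True
      with assms have r: "0 < r" "\<rho> \<le> r" by auto
      have "indicator (shadow x \<rho> e) (z, r) = (indicator (koranyi_ball x (r - \<rho>)) z :: ennreal)" for z
        using True by (simp add: shadow_def koranyi_ball_def indicator_def koranyi_dist_sym)
      then have "(\<integral>\<^sup>+z. ?g r * indicator (shadow x \<rho> e) (z, r) \<partial>heis_haar)
          = ?g r * emeasure heis_haar (koranyi_ball x (r - \<rho>))"
        by (simp add: nn_integral_cmult)
      also have "\<dots> = ennreal (\<gamma> * r powr (-5) * (r - \<rho>)^4)"
        using True r assms by (simp add: emeasure_heis_haar_koranyi_ball ennreal_mult'[symmetric])
      also have "\<gamma> * r powr (-5) * (r - \<rho>)^4 = \<gamma> * ((r - \<rho>)^4 / r^5)"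
        using r powr_realpow[of r 5] by (simp add: powr_minus_divide)
      finally show ?thesis using True by simp
    next
      case False
      then show ?thesis using assms by (auto simp: shadow_def indicator_def)
    qed
  qed
  finally show ?thesis .
qed

text \<open>At \<rho> = 0 the volume r^4 cancels the density r^-5 down to 1/r, whence the logarithm
  and later the power law e^\<gamma>. The minimum accounts for e at least 1, where the shadow
  carries no intensity.\<close>

lemma emeasure_shadow_0:
  assumes "0 < e" "0 \<le> \<gamma>"
  shows "emeasure (cutout_intensity \<gamma>) (shadow x 0 e) = ennreal (\<gamma> * ln (1 / min e 1))"
proof (cases "e < 1")
  case True
  have ae: "AE r in lborel. r \<noteq> e \<and> r \<noteq> 1"
    using AE_lborel_singleton[of e] AE_lborel_singleton[of "1::real"] by eventually_elim simp
  have "emeasure (cutout_intensity \<gamma>) (shadow x 0 e)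
      = (\<integral>\<^sup>+r. ennreal (\<gamma> * (1 / r)) * indicator {e..1} r \<partial>lborel)"
    unfolding emeasure_shadow[OF order_refl less_imp_le[OF assms(1)] assms]
    by (rule nn_integral_cong_AE, use ae in eventually_elim)
      (use assms in \<open>auto simp: indicator_def power_eq_if[of _ 5]\<close>)
  also have "\<dots> = \<gamma> * ln 1 - \<gamma> * ln e"
    using assms True
    by (intro nn_integral_FTC_Icc) (auto intro!: derivative_eq_intros simp: field_simps)
  finally show ?thesis using assms True by (simp add: ln_div)
next
  case False
  then have "indicator {e<..<1} r = (0 :: ennreal)" for r by (auto simp: indicator_def)
  with False show ?thesis
    unfolding emeasure_shadow[OF order_refl less_imp_le[OF assms(1)] assms] by (simp add: min_def)
qed

text \<open>Bernoulli gives (1 - e/r)^4 at least 1 - 4e/r, which is nonnegative from r = 4e on.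
  Restricting to [4e, 1] therefore loses only constants compared with \<rho> = 0, and the minorant
  has the antiderivative ln r + 4e/r.\<close>

lemma emeasure_shadow_ge:
  assumes "0 < e" "4 * e \<le> 1" "0 \<le> \<gamma>"
  shows "ennreal (\<gamma> * (ln (1 / (4 * e)) - 1)) \<le> emeasure (cutout_intensity \<gamma>) (shadow x e e)"
proof -
  have "ennreal (\<gamma> * (ln (1 / (4 * e)) - 1))
      \<le> ennreal (\<gamma> * (ln 1 + 4 * e / 1) - \<gamma> * (ln (4 * e) + 4 * e / (4 * e)))"
    using assms by (intro ennreal_leI) (simp add: ln_div field_simps)
  also have "\<dots> = (\<integral>\<^sup>+r. ennreal (\<gamma> * (1 / r - 4 * e / r\<^sup>2)) * indicator {4 * e..1} r \<partial>lborel)"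
  proof (rule nn_integral_FTC_Icc[symmetric])
    fix r assume r: "r \<in> {4 * e..1}"
    then have "0 < r" using assms by auto
    then show "((\<lambda>r. \<gamma> * (ln r + 4 * e / r)) has_real_derivative \<gamma> * (1 / r - 4 * e / r\<^sup>2)) (at r)"
      by (auto intro!: derivative_eq_intros simp: power2_eq_square)
    have "1 / r - 4 * e / r\<^sup>2 = (r - 4 * e) / r\<^sup>2"
      using \<open>0 < r\<close> by (simp add: diff_divide_distrib power2_eq_square)
    then show "0 \<le> \<gamma> * (1 / r - 4 * e / r\<^sup>2)"
      using r assms by simp
  qed (use assms in simp_all)
  also have "\<dots> \<le> (\<integral>\<^sup>+r. ennreal (\<gamma> * ((r - e)^4 / r^5)) * indicator {e<..<1} r \<partial>lborel)"
  proof (rule nn_integral_mono_AE, use AE_lborel_singleton[of "1::real"] in eventually_elim)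
    fix r :: real assume "r \<noteq> 1"
    show "ennreal (\<gamma> * (1 / r - 4 * e / r\<^sup>2)) * indicator {4 * e..1} r
        \<le> ennreal (\<gamma> * ((r - e)^4 / r^5)) * indicator {e<..<1} r"
    proof (cases "r \<in> {4 * e..1}")
      case True
      with assms have r: "0 < r" "e < r" by auto
      have "1 / r - 4 * e / r\<^sup>2 = 1 / r * (1 + real 4 * (- (e / r)))"
        by (simp add: diff_divide_distrib power2_eq_square)
      also have "\<dots> \<le> 1 / r * (1 + (- (e / r)))^4"
        using r assms by (intro mult_left_mono Bernoulli_inequality) auto
      also have "1 + (- (e / r)) = (r - e) / r"
        using r by (simp add: field_simps)
      also have "1 / r * ((r - e) / r)^4 = (r - e)^4 / r^5"
        by (simp add: power_divide power_eq_if[of _ 5])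
      finally have "1 / r - 4 * e / r\<^sup>2 \<le> (r - e)^4 / r^5" .
      then have "ennreal (\<gamma> * (1 / r - 4 * e / r\<^sup>2)) \<le> ennreal (\<gamma> * ((r - e)^4 / r^5))"
        using assms by (intro ennreal_leI mult_left_mono)
      moreover have "indicator {4 * e..1} r = (1::ennreal)" "indicator {e<..<1} r = (1::ennreal)"
        using True r \<open>r \<noteq> 1\<close> by auto
      ultimately show ?thesis by (simp only: mult_1_right)
    qed simp
  qed
  also have "\<dots> = emeasure (cutout_intensity \<gamma>) (shadow x e e)"
    using assms by (intro emeasure_shadow[symmetric]) auto
  finally show ?thesis .
qed

lemma shadow_mono: "\<rho>' \<le> \<rho> \<Longrightarrow> e' \<le> e \<Longrightarrow> shadow x \<rho> e \<subseteq> shadow x \<rho>' e'"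
  by (auto simp: shadow_def)

lemma emeasure_shadow_finite:
  assumes "0 \<le> \<rho>" "0 < e" "0 \<le> \<gamma>"
  shows "emeasure (cutout_intensity \<gamma>) (shadow x \<rho> e) < \<infinity>"
proof -
  have "emeasure (cutout_intensity \<gamma>) (shadow x \<rho> e) \<le> emeasure (cutout_intensity \<gamma>) (shadow x 0 e)"
    using assms by (intro emeasure_mono shadow_mono) auto
  also have "\<dots> < \<infinity>" using assms by (simp add: emeasure_shadow_0)
  finally show ?thesis .
qed

text \<open>A ball covering two points has radius larger than half their distance, so only large
  balls correlate them.\<close>

lemma shadow_Int_subset: "shadow x 0 e \<inter> shadow y 0 e \<subseteq> shadow x 0 (max e (koranyi_dist x y / 2))"
proof
  fix p assume p: "p \<in> shadow x 0 e \<inter> shadow y 0 e"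
  have "koranyi_dist x y \<le> koranyi_dist x (fst p) + koranyi_dist y (fst p)"
    using koranyi_dist_triangle[of x y "fst p"] by (simp add: koranyi_dist_sym[of y])
  with p show "p \<in> shadow x 0 (max e (koranyi_dist x y / 2))"
    by (auto simp: shadow_def)
qed

lemma measure_shadow_0:
  assumes "0 < e" "0 \<le> \<gamma>"
  shows "measure (cutout_intensity \<gamma>) (shadow x 0 e) = \<gamma> * ln (1 / min e 1)"
  using assms by (simp add: measure_def emeasure_shadow_0)

text \<open>Inclusion-exclusion: the balls covering both points have intensity at most
  \<open>\<gamma> * ln (2 / koranyi_dist x y)\<close>, a bound that does not grow as e tends to
  0.\<close>

lemma measure_shadow_Un_ge:
  assumes "0 < e" "e < 1" "0 \<le> \<gamma>" "0 < koranyi_dist x y" "koranyi_dist x y \<le> 2"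
  shows "2 * (\<gamma> * ln (1 / e)) - \<gamma> * ln (2 / koranyi_dist x y)
    \<le> measure (cutout_intensity \<gamma>) (shadow x 0 e \<union> shadow y 0 e)"
proof -
  let ?\<mu> = "cutout_intensity \<gamma>" and ?d = "koranyi_dist x y"
  have fin: "shadow z 0 e' \<in> fmeasurable ?\<mu>" if "0 < e'" for z e'
    using emeasure_shadow_finite[of 0 e' \<gamma> z] that assms by (auto intro!: fmeasurableI)
  have "measure ?\<mu> (shadow x 0 e \<inter> shadow y 0 e) \<le> measure ?\<mu> (shadow x 0 (max e (?d / 2)))"
    using assms by (intro measure_mono_fmeasurable shadow_Int_subset fin sets.Int) auto
  also have "\<dots> = \<gamma> * ln (1 / max e (?d / 2))"
    using assms by (subst measure_shadow_0) (auto simp: min_def max_def)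
  also have "\<dots> \<le> \<gamma> * ln (2 / ?d)"
    using assms by (intro mult_left_mono) (auto simp: field_simps max_def)
  finally have "measure ?\<mu> (shadow x 0 e \<inter> shadow y 0 e) \<le> \<gamma> * ln (2 / ?d)" .
  moreover have "measure ?\<mu> (shadow x 0 e \<union> shadow y 0 e) =
      measure ?\<mu> (shadow x 0 e) + measure ?\<mu> (shadow y 0 e) - measure ?\<mu> (shadow x 0 e \<inter> shadow y 0 e)"
    using assms by (intro measure_Un3 fin) auto
  moreover have "measure ?\<mu> (shadow z 0 e) = \<gamma> * ln (1 / e)" for z
    using assms by (simp add: measure_shadow_0)
  ultimately show ?thesis by simp
qed

section \<open>Uncovered points at a finite level\<close>

locale poisson_cutout = prob_space M
  for M :: "'w measure" +
  fixes N :: "'w \<Rightarrow> ((complex \<times> real) \<times> real) set" and \<gamma> :: real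
  assumes gamma_pos: "0 < \<gamma>"
    and poisson: "poisson_point_process M (cutout_intensity \<gamma>) N"
begin

definition void :: "((complex \<times> real) \<times> real) set \<Rightarrow> 'w set" where
  "void A = {\<omega> \<in> space M. N \<omega> \<inter> A = {}}"

text \<open>Phrased through \<open>shadow\<close>, so that for a fixed point of the unit ball
  survival is literally a void event.\<close>

definition level :: "real \<Rightarrow> 'w \<Rightarrow> (complex \<times> real) set" where
  "level e \<omega> = {x \<in> koranyi_cball (0, 0) 1. N \<omega> \<inter> shadow x 0 e = {}}"

text \<open>This is the case k = 0 of the Poisson law. The conjunct \<open>finite\<close> is what
  makes \<open>card = 0\<close> mean emptiness, as infinite sets have cardinality 0 too.\<close>

lemma void_event:
  assumes "A \<in> sets borel" "emeasure (cutout_intensity \<gamma>) A < \<infinity>"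
  shows "void A \<in> sets M" "emeasure M (void A) = ennreal (exp (- measure (cutout_intensity \<gamma>) A))"
proof -
  have eq: "void A = {\<omega> \<in> space M. finite (N \<omega> \<inter> A) \<and> card (N \<omega> \<inter> A) = 0}"
    by (auto simp: void_def)
  have *: "{\<omega> \<in> space M. finite (N \<omega> \<inter> A) \<and> card (N \<omega> \<inter> A) = k} \<in> sets M \<and>
      measure M {\<omega> \<in> space M. finite (N \<omega> \<inter> A) \<and> card (N \<omega> \<inter> A) = k}
        = exp (- measure (cutout_intensity \<gamma>) A) * measure (cutout_intensity \<gamma>) A ^ k / fact k" for k
    using poisson assms unfolding poisson_point_process_def by simp
  show "void A \<in> sets M"
    unfolding eq using *[of 0] by (rule conjunct1)
  show "emeasure M (void A) = ennreal (exp (- measure (cutout_intensity \<gamma>) A))"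
    unfolding eq emeasure_eq_measure using conjunct2[OF *[of 0]] by simp
qed

lemma void_shadow [measurable]: "0 \<le> \<rho> \<Longrightarrow> 0 < e \<Longrightarrow> void (shadow x \<rho> e) \<in> sets M"
  using gamma_pos by (intro void_event emeasure_shadow_finite) auto

lemma mem_level_iff:
  "x \<in> level e \<omega> \<longleftrightarrow> x \<in> koranyi_cball (0, 0) 1 \<and>
    (\<forall>z r. (z, r) \<in> N \<omega> \<longrightarrow> e < r \<longrightarrow> \<not> koranyi_dist x z < r)"
  by (auto simp: level_def shadow_def)

lemma mem_cutout_set_iff:
  "x \<in> cutout_set P \<longleftrightarrow> x \<in> koranyi_cball (0, 0) 1 \<and>
    (\<forall>z r. (z, r) \<in> P \<longrightarrow> \<not> koranyi_dist x z < r)"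
  by (auto simp: cutout_set_def koranyi_ball_def)

text \<open>Any union of open balls is open, however many balls there are, so a closed subset of the
  compact unit ball remains.\<close>

lemma compact_level: "compact (level e \<omega>)"
proof -
  have "open (\<Union>(z, r)\<in>{p \<in> N \<omega>. e < snd p}. koranyi_ball z r)"
    by (intro open_UN) auto
  moreover have "level e \<omega> = koranyi_cball (0, 0) 1 - (\<Union>(z, r)\<in>{p \<in> N \<omega>. e < snd p}. koranyi_ball z r)"
    by (auto simp: mem_level_iff koranyi_ball_def)
  ultimately show ?thesis
    by (simp only:) (intro compact_diff compact_koranyi_unit_cball)
qed

lemma level_mono: "e \<le> e' \<Longrightarrow> level e \<omega> \<subseteq> level e' \<omega>"
  by (meson mem_level_iff order_le_less_trans subsetI)

lemma cutout_set_subset_level: "cutout_set (N \<omega>) \<subseteq> level e \<omega>"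
  by (meson mem_cutout_set_iff mem_level_iff subsetI)

text \<open>A ball that covers a point has positive radius and so is seen at some level. The shift
  by 2 keeps every level strictly between 0 and 1, the range in which the moments are
  computed.\<close>

lemma cutout_set_eq_Inter_level: "cutout_set (N \<omega>) = (\<Inter>n::nat. level (1 / (n + 2)) \<omega>)"
proof (intro antisym INT_greatest cutout_set_subset_level subsetI)
  fix x assume x: "x \<in> (\<Inter>n::nat. level (1 / (n + 2)) \<omega>)"
  then have lev: "x \<in> level (1 / (real n + 2)) \<omega>" for n
    by simp
  have "\<not> koranyi_dist x z < r" if zr: "(z, r) \<in> N \<omega>" for z r
  proof
    assume d: "koranyi_dist x z < r"
    then have "0 < r" by (rule le_less_trans[OF koranyi_dist_nonneg])
    then obtain n :: nat where "inverse (real (Suc n)) < r"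
      using reals_Archimedean by blast
    moreover have "1 / (real n + 2) \<le> inverse (real (Suc n))"
      by (simp add: field_simps)
    ultimately have "1 / (real n + 2) < r" by linarith
    then show False using lev[of n] zr d unfolding mem_level_iff by metis
  qed
  then show "x \<in> cutout_set (N \<omega>)"
    using lev[of 0] unfolding mem_cutout_set_iff mem_level_iff by metis
qed

text \<open>Only void events of fixed sets are known to be measurable, so the uncovered region is made
  jointly measurable by testing the covering of a countable family of small balls.\<close>
lemma sets_level:
  assumes "0 < e"
  shows "{p \<in> space (M \<Otimes>\<^sub>M borel). snd p \<in> level e (fst p)} \<in> sets (M \<Otimes>\<^sub>M borel)"
proof -
  obtain D :: "(complex \<times> real) set"
    where D: "countable D" "\<And>X. open X \<Longrightarrow> X \<noteq> {} \<Longrightarrow> \<exists>d\<in>D. d \<in> X"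
    by (rule countable_dense_setE) blast
  define R where "R = {\<rho> \<in> \<rat>. (0::real) < \<rho>}"
  have "countable R" unfolding R_def using countable_rat by (rule countable_subset[rotated]) auto
  \<comment> \<open>A pair lies in \<open>C\<close> when x sits in a small ball B(q, \<rho>), with q
    and \<rho> from countable sets, that is swallowed whole by some ball of the process.\<close>
  define C where "C = (\<Union>q\<in>D. \<Union>\<rho>\<in>R. (space M - void (shadow q \<rho> e)) \<times> koranyi_ball q \<rho>)"
  have "C \<in> sets (M \<Otimes>\<^sub>M borel)"
    unfolding C_def using D(1) \<open>countable R\<close> assms
    by (intro sets.countable_UN' pair_measureI sets.Diff sets.top void_shadow sets_koranyi_ball)
      (auto simp: R_def)
  have "{p \<in> space (M \<Otimes>\<^sub>M borel). snd p \<in> level e (fst p)} = space M \<times> koranyi_cball (0, 0) 1 - C"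
  proof (intro equalityI subsetI)
    fix p assume p: "p \<in> {p \<in> space (M \<Otimes>\<^sub>M borel). snd p \<in> level e (fst p)}"
    then obtain \<omega> x where [simp]: "p = (\<omega>, x)" and \<omega>: "\<omega> \<in> space M" and x: "x \<in> level e \<omega>"
      by (cases p) (auto simp: space_pair_measure)
    have "p \<notin> C"
    proof
      assume "p \<in> C"
      then obtain q \<rho> where \<rho>: "0 < \<rho>" and nv: "\<omega> \<notin> void (shadow q \<rho> e)" and "x \<in> koranyi_ball q \<rho>"
        by (auto simp: C_def R_def)
      then have xq: "koranyi_dist x q < \<rho>" by (simp add: koranyi_ball_def)
      from nv \<omega> obtain z r where zr: "(z, r) \<in> N \<omega>" "e < r" "koranyi_dist q z < r - \<rho>"
        by (auto simp: void_def shadow_def)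
      have "koranyi_dist x z < r"
        using koranyi_dist_triangle[of x z q] xq zr by linarith
      then have "(z, r) \<in> N \<omega> \<inter> shadow x 0 e" using zr by (simp add: shadow_def)
      with x show False by (auto simp: level_def)
    qed
    then show "p \<in> space M \<times> koranyi_cball (0, 0) 1 - C"
      using \<omega> x by (auto simp: level_def)
  next
    fix p assume p: "p \<in> space M \<times> koranyi_cball (0, 0) 1 - C"
    then obtain \<omega> x where [simp]: "p = (\<omega>, x)" and \<omega>: "\<omega> \<in> space M"
      and x: "x \<in> koranyi_cball (0, 0) 1" and nC: "(\<omega>, x) \<notin> C"
      by auto
    have "N \<omega> \<inter> shadow x 0 e = {}"
    proof (rule ccontr)
      assume "N \<omega> \<inter> shadow x 0 e \<noteq> {}"
      then obtain z r where zr: "(z, r) \<in> N \<omega>" "e < r" "koranyi_dist x z < r"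
        by (auto simp: shadow_def)
      \<comment> \<open>Half of the slack: one \<rho> pays for moving from x to q, the other for the
        margin demanded by \<open>shadow q \<rho> e\<close>.\<close>
      then obtain \<rho> where \<rho>: "\<rho> \<in> \<rat>" "0 < \<rho>" "\<rho> < (r - koranyi_dist x z) / 2"
        using Rats_dense_in_real[of 0 "(r - koranyi_dist x z) / 2"] by auto
      have "x \<in> koranyi_ball x \<rho>" using \<rho> by (simp add: koranyi_ball_def)
      then obtain q where q: "q \<in> D" "q \<in> koranyi_ball x \<rho>"
        using D(2)[OF open_koranyi_ball, of x \<rho>] by blast
      then have d: "koranyi_dist q x < \<rho>" "koranyi_dist x q < \<rho>"
        by (simp_all add: koranyi_ball_def koranyi_dist_sym)
      then have "koranyi_dist q z < r - \<rho>"
        using koranyi_dist_triangle[of q z x] \<rho> by (simp add: field_simps)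
      then have "\<omega> \<notin> void (shadow q \<rho> e)"
        using zr by (auto simp: void_def shadow_def)
      then have "(\<omega>, x) \<in> C"
        using \<omega> q \<rho> d by (auto simp: C_def R_def koranyi_ball_def)
      with nC show False by simp
    qed
    then show "p \<in> {p \<in> space (M \<Otimes>\<^sub>M borel). snd p \<in> level e (fst p)}"
      using \<omega> x by (simp add: space_pair_measure level_def)
  qed
  also have "\<dots> \<in> sets (M \<Otimes>\<^sub>M borel)"
    using \<open>C \<in> _\<close> by (intro sets.Diff pair_measureI) (auto intro: borel_closed)
  finally show ?thesis .
qed

lemma borel_measurable_indicator_level [measurable]:
  assumes "0 < e" and [measurable]: "f \<in> measurable A M" "g \<in> borel_measurable A"
  shows "(\<lambda>x. indicator (level e (f x)) (g x) :: ennreal) \<in> borel_measurable A"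
proof -
  note sets_level[OF assms(1), measurable]
  have "(\<lambda>x. indicator {p \<in> space (M \<Otimes>\<^sub>M borel). snd p \<in> level e (fst p)} (f x, g x) :: ennreal)
      \<in> borel_measurable A"
    by (rule measurable_compose_rev[where g = "\<lambda>x. (f x, g x)"]) measurable
  then show ?thesis
    by (rule measurable_cong[THEN iffD1, rotated])
      (auto simp: indicator_def space_pair_measure intro: measurable_space[OF assms(2)])
qed

lemma exp_neg_gamma_ln:
  assumes "0 < a"
  shows "exp (- (\<gamma> * ln (1 / a))) = a powr \<gamma>"
  using assms by (simp add: powr_def ln_div)

lemma emeasure_mem_level:
  assumes "0 < e" "e < 1" "x \<in> koranyi_cball (0, 0) 1"
  shows "(\<integral>\<^sup>+\<omega>. indicator (level e \<omega>) x \<partial>M) = ennreal (e powr \<gamma>)"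
proof -
  have "(\<integral>\<^sup>+\<omega>. indicator (level e \<omega>) x \<partial>M) = (\<integral>\<^sup>+\<omega>. indicator (void (shadow x 0 e)) \<omega> \<partial>M)"
    using assms by (intro nn_integral_cong) (auto simp: level_def void_def indicator_def)
  also have "\<dots> = emeasure M (void (shadow x 0 e))"
    using assms by (intro nn_integral_indicator void_shadow) auto
  also have "\<dots> = ennreal (e powr \<gamma>)"
    using assms gamma_pos emeasure_shadow_finite[of 0 e \<gamma> x]
    by (simp add: void_event measure_shadow_0 exp_neg_gamma_ln min_def)
  finally show ?thesis .
qed

text \<open>Both points survive exactly when the union of their shadows is void. Exponentiating
  \<open>measure_shadow_Un_ge\<close> turns its subtracted term into the correlation factor.\<close>

lemma emeasure_pair_mem_level:
  assumes "0 < e" "e < 1" "x \<in> koranyi_cball (0, 0) 1" "y \<in> koranyi_cball (0, 0) 1"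
    and pos: "0 < koranyi_dist x y"
  shows "(\<integral>\<^sup>+\<omega>. indicator (level e \<omega>) x * indicator (level e \<omega>) y \<partial>M)
    \<le> ennreal ((e powr \<gamma>)\<^sup>2 * (2 / koranyi_dist x y) powr \<gamma>)"
proof -
  let ?U = "shadow x 0 e \<union> shadow y 0 e"
  have fin: "shadow z 0 e \<in> fmeasurable (cutout_intensity \<gamma>)" for z
    using emeasure_shadow_finite[of 0 e \<gamma> z] assms gamma_pos by (auto intro!: fmeasurableI)
  then have "?U \<in> fmeasurable (cutout_intensity \<gamma>)" by (intro fmeasurable.Un)
  then have U: "?U \<in> sets borel" "emeasure (cutout_intensity \<gamma>) ?U < \<infinity>"
    by (auto simp: fmeasurable_def)
  have "koranyi_dist x y \<le> koranyi_dist x (0, 0) + koranyi_dist (0, 0) y"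
    by (rule koranyi_dist_triangle)
  also have "\<dots> \<le> 2" using assms by (simp add: koranyi_cball_def)
  finally have d: "koranyi_dist x y \<le> 2" .
  have "(\<integral>\<^sup>+\<omega>. indicator (level e \<omega>) x * indicator (level e \<omega>) y \<partial>M)
      = (\<integral>\<^sup>+\<omega>. indicator (void ?U) \<omega> \<partial>M)"
    using assms by (intro nn_integral_cong) (auto simp: level_def void_def indicator_def)
  also have "\<dots> = emeasure M (void ?U)"
    using U by (intro nn_integral_indicator void_event) auto
  also have "\<dots> = ennreal (exp (- measure (cutout_intensity \<gamma>) ?U))"
    using U by (rule void_event)
  also have "\<dots> \<le> ennreal (exp (- (2 * (\<gamma> * ln (1 / e)) - \<gamma> * ln (2 / koranyi_dist x y))))"
    using measure_shadow_Un_ge[of e \<gamma> x y] assms gamma_pos d by (intro ennreal_leI) auto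
  also have "exp (- (2 * (\<gamma> * ln (1 / e)) - \<gamma> * ln (2 / koranyi_dist x y)))
      = exp (- (\<gamma> * ln (1 / e))) * exp (- (\<gamma> * ln (1 / e))) * exp (\<gamma> * ln (2 / koranyi_dist x y))"
    by (simp add: exp_add[symmetric])
  also have "\<dots> = (e powr \<gamma>)\<^sup>2 * (2 / koranyi_dist x y) powr \<gamma>"
    using assms by (simp add: exp_neg_gamma_ln power2_eq_square powr_def)
  finally show ?thesis .
qed

text \<open>A surviving point within e of x would be covered by any ball that contains the whole
  ball of radius e about x. This replaces the event of hitting V, perhaps not measurable, by a
  larger void event.\<close>

lemma hit_imp_void:
  assumes "\<omega> \<in> space M" "V \<subseteq> koranyi_cball x e" "V \<inter> cutout_set (N \<omega>) \<noteq> {}"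
  shows "\<omega> \<in> void (shadow x e e)"
proof -
  from assms obtain y where y: "koranyi_dist y x \<le> e" "y \<in> cutout_set (N \<omega>)"
    by (auto simp: koranyi_cball_def)
  have "(z, r) \<notin> shadow x e e" if "(z, r) \<in> N \<omega>" for z r
  proof
    assume "(z, r) \<in> shadow x e e"
    then have "koranyi_dist y z < r"
      using koranyi_dist_triangle[of y z x] y by (auto simp: shadow_def)
    with that y(2) show False by (auto simp: cutout_set_def koranyi_ball_def)
  qed
  with assms(1) show ?thesis by (auto simp: void_def)
qed

text \<open>The factor \<open>4 * exp 1\<close> is what the constants lost in
  \<open>emeasure_shadow_ge\<close> become after exponentiation. For 4e > 1 the bound is at least 1
  and hence trivial.\<close>

lemma emeasure_void_shadow_le:
  assumes "0 < e"
  shows "emeasure M (void (shadow x e e)) \<le> ennreal ((4 * exp 1 * e) powr \<gamma>)"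
proof (cases "4 * e \<le> 1")
  case True
  let ?m = "measure (cutout_intensity \<gamma>) (shadow x e e)"
  have fin: "emeasure (cutout_intensity \<gamma>) (shadow x e e) < \<infinity>"
    using assms gamma_pos by (intro emeasure_shadow_finite) auto
  then have "ennreal (\<gamma> * (ln (1 / (4 * e)) - 1)) \<le> ennreal ?m"
    using emeasure_shadow_ge[of e \<gamma> x] assms True gamma_pos
    by (subst emeasure_eq_ennreal_measure[symmetric]) auto
  then have "\<gamma> * (ln (1 / (4 * e)) - 1) \<le> ?m" by simp
  then have "exp (- ?m) \<le> exp (- (\<gamma> * (ln (1 / (4 * e)) - 1)))" by simp
  also have "\<dots> = (4 * exp 1 * e) powr \<gamma>"
    using assms by (simp add: powr_def ln_div ln_mult algebra_simps)
  finally show ?thesis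
    using fin by (simp add: void_event ennreal_leI)
next
  case False
  have "1 * 1 \<le> exp 1 * (4 * e)"
    using False by (intro mult_mono) auto
  then have "1 \<le> (4 * exp 1 * e) powr \<gamma>"
    using gamma_pos by (intro ge_one_powr_ge_zero) (auto simp: mult_ac)
  then have "1 \<le> ennreal ((4 * exp 1 * e) powr \<gamma>)"
    by (metis ennreal_1 ennreal_leI)
  then show ?thesis
    using emeasure_le_1 order_trans by blast
qed

end

section \<open>The upper bound\<close>

lemma hd_gauge_nonneg [simp]: "0 \<le> hd_gauge s U"
  by (simp add: hd_gauge_def)

lemma hd_gauge_empty [simp]: "hd_gauge s {} = 0"
  by (simp add: hd_gauge_def)

lemma hausdorff_measure_eq_0I:
  fixes A :: "'a::metric_space set"
  assumes "\<And>\<delta> \<eta>. 0 < \<delta> \<Longrightarrow> 0 < \<eta> \<Longrightarrow> \<exists>U :: nat \<Rightarrow> 'a set. A \<subseteq> (\<Union>i. U i) \<and>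
    (\<forall>i. bounded (U i) \<and> diameter (U i) \<le> \<delta>) \<and> (\<Sum>i. ennreal (hd_gauge s (U i))) \<le> ennreal \<eta>"
  shows "hausdorff_measure s A = 0"
proof -
  have "hausdorff_premeasure s \<delta> A \<le> 0" if "0 < \<delta>" for \<delta>
  proof (rule ennreal_le_epsilon)
    fix \<eta> :: real assume "0 < \<eta>"
    from assms[OF that this] obtain U :: "nat \<Rightarrow> 'a set" where U: "A \<subseteq> (\<Union>i. U i)"
      "\<forall>i. bounded (U i) \<and> diameter (U i) \<le> \<delta>" "(\<Sum>i. ennreal (hd_gauge s (U i))) \<le> ennreal \<eta>"
      by (elim exE conjE)
    have "hausdorff_premeasure s \<delta> A \<le> (\<Sum>i. ennreal (hd_gauge s (U i)))"
      unfolding hausdorff_premeasure_def by (intro INF_lower CollectI conjI U)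
    with U(3) show "hausdorff_premeasure s \<delta> A \<le> 0 + ennreal \<eta>" by (metis add_0 order_trans)
  qed
  then have "hausdorff_measure s A \<le> 0"
    unfolding hausdorff_measure_def by (intro SUP_least) simp
  then show ?thesis by simp
qed

lemma hausdorff_measure_eq_0D:
  fixes A :: "'a::metric_space set"
  assumes "hausdorff_measure s A = 0" "0 < \<delta>" "0 < \<eta>"
  obtains U :: "nat \<Rightarrow> 'a set" where "A \<subseteq> (\<Union>i. U i)"
    "\<And>i. bounded (U i)" "\<And>i. diameter (U i) \<le> \<delta>" "(\<Sum>i. ennreal (hd_gauge s (U i))) < ennreal \<eta>"
proof -
  have "hausdorff_premeasure s \<delta> A \<le> hausdorff_measure s A"
    unfolding hausdorff_measure_def using assms(2) by (intro SUP_upper) simp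
  then have "hausdorff_premeasure s \<delta> A < ennreal \<eta>"
    using assms by simp
  then show thesis
    unfolding hausdorff_premeasure_def INF_less_iff using that by blast
qed

lemma hausdorff_measure_eq_0_mono:
  fixes A :: "'a::metric_space set"
  assumes "hausdorff_measure s A = 0" "0 \<le> s" "s \<le> s'"
  shows "hausdorff_measure s' A = 0"
proof (rule hausdorff_measure_eq_0I)
  fix \<delta> \<eta> :: real assume "0 < \<delta>" "0 < \<eta>"
  \<comment> \<open>Diameters at most 1 make the gauge decrease as the exponent grows.\<close>
  then have "0 < min \<delta> 1" by simp
  obtain U :: "nat \<Rightarrow> 'a set" where U: "A \<subseteq> (\<Union>i. U i)"
    "\<And>i. bounded (U i)" "\<And>i. diameter (U i) \<le> min \<delta> 1" "(\<Sum>i. ennreal (hd_gauge s (U i))) < ennreal \<eta>"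
    by (rule hausdorff_measure_eq_0D[OF assms(1) \<open>0 < min \<delta> 1\<close> \<open>0 < \<eta>\<close>]) blast
  have "hd_gauge s' (U i) \<le> hd_gauge s (U i)" for i
  proof -
    have "0 \<le> diameter (U i)" "diameter (U i) \<le> 1"
      using U(2,3)[of i] by (auto intro: diameter_ge_0)
    then show ?thesis
      using assms(2,3) by (cases "s' = 0") (auto simp: hd_gauge_def intro: powr_le1 powr_mono')
  qed
  then have "(\<Sum>i. ennreal (hd_gauge s' (U i))) \<le> (\<Sum>i. ennreal (hd_gauge s (U i)))"
    by (intro suminf_le ennreal_leI) auto
  also note U(4)
  finally show "\<exists>U :: nat \<Rightarrow> 'a set. A \<subseteq> (\<Union>i. U i) \<and>
    (\<forall>i. bounded (U i) \<and> diameter (U i) \<le> \<delta>) \<and> (\<Sum>i. ennreal (hd_gauge s' (U i))) \<le> ennreal \<eta>"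
    using U(1-3) by (intro exI[of _ U]) auto
qed

text \<open>A finite cover becomes a sequence by padding with empty sets, whose gauge is 0 even for
  s = 0.\<close>

lemma hausdorff_measure_eq_0_finite_cover:
  fixes A :: "'a::metric_space set"
  assumes "\<And>\<delta> \<eta>. 0 < \<delta> \<Longrightarrow> 0 < \<eta> \<Longrightarrow> \<exists>(I :: 'i set) U. finite I \<and> A \<subseteq> (\<Union>i\<in>I. U i) \<and>
    (\<forall>i\<in>I. bounded (U i) \<and> diameter (U i) \<le> \<delta>) \<and> (\<Sum>i\<in>I. hd_gauge s (U i)) \<le> \<eta>"
  shows "hausdorff_measure s A = 0"
proof (rule hausdorff_measure_eq_0I)
  fix \<delta> \<eta> :: real assume pos: "0 < \<delta>" "0 < \<eta>"
  then obtain I :: "'i set" and U where U: "finite I" "A \<subseteq> (\<Union>i\<in>I. U i)"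
    "\<And>i. i \<in> I \<Longrightarrow> bounded (U i) \<and> diameter (U i) \<le> \<delta>" "(\<Sum>i\<in>I. hd_gauge s (U i)) \<le> \<eta>"
    using assms by meson
  obtain h where h: "bij_betw h {..<card I} I"
    using ex_bij_betw_nat_finite[OF U(1)] by (auto simp: atLeast0LessThan)
  define W where "W n = (if n < card I then U (h n) else {})" for n
  have hI: "h n \<in> I" if "n < card I" for n
    using h that by (auto dest: bij_betwE)
  have "\<exists>n. x \<in> W n" if xA: "x \<in> A" for x
  proof -
    obtain i where i: "i \<in> I" "x \<in> U i" using U(2) xA by blast
    then obtain n where "n < card I" "h n = i"
      using h by (metis bij_betw_imp_surj_on imageE lessThan_iff)
    with i show ?thesis by (auto simp: W_def)
  qed
  then have "A \<subseteq> (\<Union>n. W n)" by blast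
  moreover have "bounded (W n) \<and> diameter (W n) \<le> \<delta>" for n
    using U(3) hI pos by (auto simp: W_def diameter_empty)
  moreover have "(\<Sum>n. ennreal (hd_gauge s (W n))) \<le> ennreal \<eta>"
  proof -
    have "(\<Sum>n. ennreal (hd_gauge s (W n))) = (\<Sum>n<card I. ennreal (hd_gauge s (W n)))"
      by (rule suminf_finite) (auto simp: W_def)
    also have "\<dots> = (\<Sum>n<card I. ennreal (hd_gauge s (U (h n))))"
      by (intro sum.cong) (auto simp: W_def)
    also have "\<dots> = (\<Sum>i\<in>I. ennreal (hd_gauge s (U i)))"
      by (rule sum.reindex_bij_betw[OF h])
    also have "\<dots> \<le> ennreal \<eta>"
      using U(4) by (simp add: sum_ennreal ennreal_leI)
    finally show ?thesis .
  qed
  ultimately show "\<exists>U :: nat \<Rightarrow> 'a set. A \<subseteq> (\<Union>i. U i) \<and>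
    (\<forall>i. bounded (U i) \<and> diameter (U i) \<le> \<delta>) \<and> (\<Sum>i. ennreal (hd_gauge s (U i))) \<le> ennreal \<eta>"
    by blast
qed

lemma suminf_ennreal_finite_tendsto_0:
  fixes f :: "nat \<Rightarrow> ennreal"
  assumes "(\<Sum>n. f n) < \<infinity>" "0 < \<eta>"
  shows "\<forall>\<^sub>F n in sequentially. f n < ennreal \<eta>"
proof -
  have fin: "f n < \<infinity>" for n
    using assms(1) ennreal_suminf_lessD[of f \<infinity> n] by auto
  define g where "g n = enn2real (f n)" for n
  have f: "f n = ennreal (g n)" for n
    using fin[of n] by (simp add: g_def)
  have "(\<lambda>n. ennreal (g n)) = f" using f by auto
  then have "summable g"
    using assms(1) by (intro summable_suminf_not_top) (auto simp: g_def less_top)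
  then have "g \<longlonglongrightarrow> 0" by (rule summable_LIMSEQ_zero)
  then have "\<forall>\<^sub>F n in sequentially. g n < \<eta>"
    using assms(2) by (rule order_tendstoD)
  then show ?thesis
    by eventually_elim (use assms(2) in \<open>simp add: f ennreal_lessI\<close>)
qed

section \<open>Almost sure null covers from a first moment bound\<close>

context poisson_cutout
begin

text \<open>\<open>S n\<close> charges each cell of stage n whose void event occurs. It is
  measurable and dominates the cost of the cells that really meet the random set. Summable
  expectations make the series of the \<open>S n\<close> finite almost surely, so its terms tend to
  0 and give covers of arbitrarily small cost.\<close>

lemma AE_hausdorff_measure_cutout_eq_0:
  fixes I :: "nat \<Rightarrow> 'i set" and V :: "nat \<Rightarrow> 'i \<Rightarrow> (complex \<times> real) set"
  assumes "0 < s" "\<And>n. finite (I n)" "\<And>n. 0 < e n" "\<And>n. 0 < \<delta> n" "\<delta> \<longlonglongrightarrow> 0"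
    and cover: "\<And>n. koranyi_cball (0, 0) 1 \<subseteq> (\<Union>i\<in>I n. V n i)"
    and V: "\<And>n i. i \<in> I n \<Longrightarrow> V n i \<subseteq> koranyi_cball (x n i) (e n)"
      "\<And>n i. i \<in> I n \<Longrightarrow> bounded (V n i)" "\<And>n i. i \<in> I n \<Longrightarrow> diameter (V n i) \<le> \<delta> n"
    and summable: "summable (\<lambda>n. real (card (I n)) * (4 * exp 1 * e n) powr \<gamma> * \<delta> n powr s)"
  shows "AE \<omega> in M. hausdorff_measure s (cutout_set (N \<omega>)) = 0"
proof -
  let ?H = "\<lambda>n i. void (shadow (x n i) (e n) (e n))"
  define S where "S n \<omega> = (\<Sum>i\<in>I n. ennreal (\<delta> n powr s) * indicator (?H n i) \<omega>)" for n \<omega>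
  have [measurable]: "?H n i \<in> sets M" for n i
    using assms(3)[of n] by (intro void_shadow) auto
  have [measurable]: "S n \<in> borel_measurable M" for n
    unfolding S_def by measurable
  have "(\<integral>\<^sup>+\<omega>. S n \<omega> \<partial>M) \<le> ennreal (real (card (I n)) * (4 * exp 1 * e n) powr \<gamma> * \<delta> n powr s)" for n
  proof -
    have "(\<integral>\<^sup>+\<omega>. S n \<omega> \<partial>M) = (\<Sum>i\<in>I n. ennreal (\<delta> n powr s) * emeasure M (?H n i))"
      unfolding S_def by (subst nn_integral_sum) (auto simp: nn_integral_cmult)
    also have "\<dots> \<le> (\<Sum>i\<in>I n. ennreal (\<delta> n powr s) * ennreal ((4 * exp 1 * e n) powr \<gamma>))"
      using assms(3) by (intro sum_mono mult_left_mono emeasure_void_shadow_le) auto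
    also have "\<dots> = ennreal (real (card (I n)) * (4 * exp 1 * e n) powr \<gamma> * \<delta> n powr s)"
      by (simp add: ennreal_mult''[symmetric] ennreal_of_nat_eq_real_of_nat mult_ac)
    finally show ?thesis .
  qed
  then have "(\<Sum>n. \<integral>\<^sup>+\<omega>. S n \<omega> \<partial>M)
      \<le> (\<Sum>n. ennreal (real (card (I n)) * (4 * exp 1 * e n) powr \<gamma> * \<delta> n powr s))"
    by (intro suminf_le) auto
  also have "\<dots> < \<infinity>"
    using summable by (subst suminf_ennreal2) auto
  finally have "(\<integral>\<^sup>+\<omega>. (\<Sum>n. S n \<omega>) \<partial>M) < \<infinity>"
    by (subst nn_integral_suminf) auto
  then have "AE \<omega> in M. (\<Sum>n. S n \<omega>) \<noteq> \<infinity>"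
    by (intro nn_integral_noteq_infinite) auto
  then show ?thesis
  proof (rule AE_mp, intro AE_I2 impI)
    fix \<omega> assume \<omega>: "\<omega> \<in> space M" and fin: "(\<Sum>n. S n \<omega>) \<noteq> \<infinity>"
    show "hausdorff_measure s (cutout_set (N \<omega>)) = 0"
    proof (rule hausdorff_measure_eq_0_finite_cover[where 'i = 'i])
      fix \<delta>' \<eta> :: real assume pos: "0 < \<delta>'" "0 < \<eta>"
      have "\<forall>\<^sub>F n in sequentially. S n \<omega> < ennreal \<eta>"
        using fin pos by (intro suminf_ennreal_finite_tendsto_0) (auto simp: less_top)
      moreover have "\<forall>\<^sub>F n in sequentially. \<delta> n < \<delta>'"
        using assms(5) pos by (intro order_tendstoD)
      ultimately obtain n where n: "S n \<omega> < ennreal \<eta>" "\<delta> n < \<delta>'"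
        using eventually_happens'[OF sequentially_bot eventually_conj] by blast
      define J where "J = {i \<in> I n. \<omega> \<in> ?H n i}"
      have fJ: "finite J" unfolding J_def using assms(2) by simp
      have "cutout_set (N \<omega>) \<subseteq> (\<Union>i\<in>J. V n i)"
      proof
        fix y assume y: "y \<in> cutout_set (N \<omega>)"
        then have "y \<in> koranyi_cball (0, 0) 1" by (simp add: mem_cutout_set_iff)
        then obtain i where i: "i \<in> I n" "y \<in> V n i" using cover[of n] by blast
        with y have "\<omega> \<in> ?H n i"
          using \<omega> V(1)[OF i(1)] by (intro hit_imp_void) auto
        with i show "y \<in> (\<Union>i\<in>J. V n i)" by (auto simp: J_def)
      qed
      moreover have "(\<Sum>i\<in>J. hd_gauge s (V n i)) \<le> \<eta>"
      proof -
        have g: "hd_gauge s (V n i) \<le> \<delta> n powr s" if "i \<in> J" for i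
          using V(2,3)[of i n] that assms(1) diameter_ge_0[of "V n i"]
          by (auto simp: hd_gauge_def J_def intro!: powr_mono2)
        have "ennreal (\<Sum>i\<in>J. hd_gauge s (V n i)) = (\<Sum>i\<in>J. ennreal (hd_gauge s (V n i)))"
          by (simp add: sum_ennreal)
        also have "\<dots> \<le> (\<Sum>i\<in>J. ennreal (\<delta> n powr s))"
          by (intro sum_mono ennreal_leI g)
        also have "\<dots> = (\<Sum>i\<in>J. ennreal (\<delta> n powr s) * indicator (?H n i) \<omega>)"
          by (intro sum.cong) (auto simp: J_def)
        also have "\<dots> \<le> S n \<omega>"
          unfolding S_def using assms(2) by (intro sum_mono2) (auto simp: J_def)
        also note n(1)
        finally show ?thesis
          using pos by (simp add: ennreal_less_iff sum_nonneg)
      qed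
      moreover have "\<forall>i\<in>J. bounded (V n i) \<and> diameter (V n i) \<le> \<delta>'"
      proof (rule ballI)
        fix i assume "i \<in> J"
        then have "i \<in> I n" by (simp add: J_def)
        from V(2)[OF this] V(3)[OF this] n(2)
        show "bounded (V n i) \<and> diameter (V n i) \<le> \<delta>'" by linarith
      qed
      ultimately have "finite J \<and> cutout_set (N \<omega>) \<subseteq> (\<Union>i\<in>J. V n i) \<and>
          (\<forall>i\<in>J. bounded (V n i) \<and> diameter (V n i) \<le> \<delta>') \<and> (\<Sum>i\<in>J. hd_gauge s (V n i)) \<le> \<eta>"
        by (intro conjI fJ)
      then show "\<exists>(I :: 'i set) U. finite I \<and> cutout_set (N \<omega>) \<subseteq> (\<Union>i\<in>I. U i) \<and>
          (\<forall>i\<in>I. bounded (U i) \<and> diameter (U i) \<le> \<delta>') \<and> (\<Sum>i\<in>I. hd_gauge s (U i)) \<le> \<eta>"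
        by (rule_tac exI[of _ J], rule_tac exI[of _ "V n"])
    qed
  qed
qed

end

text \<open>Cells of horizontal side \<open>1/m\<close> and height \<open>1/k\<close>, sheared along the plane spanned by the horizontal
  directions at the grid point \<open>w\<close> of the column.\<close>
definition heis_cell :: "nat \<Rightarrow> nat \<Rightarrow> int \<times> int \<times> int \<Rightarrow> (complex \<times> real) set" where
  "heis_cell m k = (\<lambda>(a, b, l). {p \<in> koranyi_cball (0, 0) 1.
     \<lfloor>m * Re (fst p)\<rfloor> = a \<and> \<lfloor>m * Im (fst p)\<rfloor> = b \<and>
     \<lfloor>k * (snd p - Im (cnj (Complex (a / m) (b / m)) * fst p))\<rfloor> = l})"

definition heis_cell_center :: "nat \<Rightarrow> nat \<Rightarrow> int \<times> int \<times> int \<Rightarrow> complex \<times> real" where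
  "heis_cell_center m k = (\<lambda>(a, b, l). (Complex (a / m) (b / m), l / k))"

text \<open>On the unit ball the real and imaginary parts are at most 1. The sheared height is at
  most 3: the height itself is at most 1/2, and the shear at most 2 because the grid point has
  modulus at most 2.\<close>

definition heis_cell_index :: "nat \<Rightarrow> nat \<Rightarrow> (int \<times> int \<times> int) set" where
  "heis_cell_index m k = {- int m..int m} \<times> {- int m..int m} \<times> {- (3 * int k)..3 * int k}"

lemma finite_heis_cell_index [simp]: "finite (heis_cell_index m k)"
  by (simp add: heis_cell_index_def)

lemma card_heis_cell_index_le:
  assumes "1 \<le> m" "1 \<le> k"
  shows "real (card (heis_cell_index m k)) \<le> 63 * (real m)\<^sup>2 * real k"
proof -
  have "card (heis_cell_index m k) = (2 * m + 1) * ((2 * m + 1) * (6 * k + 1))"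
    by (simp add: heis_cell_index_def card_cartesian_product nat_add_distrib nat_mult_distrib)
  also have "\<dots> \<le> (3 * m) * ((3 * m) * (7 * k))"
    using assms by (intro mult_mono) auto
  finally have "real (card (heis_cell_index m k)) \<le> real ((3 * m) * ((3 * m) * (7 * k)))"
    by (simp only: of_nat_le_iff)
  then show ?thesis by (simp add: power2_eq_square)
qed

lemma floor_grid:
  assumes "0 < m"
  shows "0 \<le> x - \<lfloor>real m * x\<rfloor> / m" "x - \<lfloor>real m * x\<rfloor> / m \<le> 1 / m"
proof -
  have "0 \<le> real m * x - \<lfloor>real m * x\<rfloor>" "real m * x - \<lfloor>real m * x\<rfloor> \<le> 1"
    by linarith+
  then have "0 \<le> (real m * x - \<lfloor>real m * x\<rfloor>) / m" "(real m * x - \<lfloor>real m * x\<rfloor>) / m \<le> 1 / m"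
    by (intro divide_nonneg_nonneg divide_right_mono; simp)+
  moreover have "x - \<lfloor>real m * x\<rfloor> / m = (real m * x - \<lfloor>real m * x\<rfloor>) / m"
    using assms by (simp add: diff_divide_distrib)
  ultimately show "0 \<le> x - \<lfloor>real m * x\<rfloor> / m" "x - \<lfloor>real m * x\<rfloor> / m \<le> 1 / m"
    by (simp_all only:)
qed

lemma floor_grid_bound:
  assumes "\<bar>x\<bar> \<le> real c"
  shows "\<lfloor>real m * x\<rfloor> \<in> {- (int c * int m)..int c * int m}"
proof -
  have "real m * \<bar>x\<bar> \<le> real m * real c"
    using assms by (intro mult_left_mono) auto
  then have "\<bar>real m * x\<bar> \<le> of_int (int c * int m)"
    by (simp add: abs_mult mult.commute)
  then have "- of_int (int c * int m) \<le> real m * x" "real m * x \<le> of_int (int c * int m)"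
    by linarith+
  then show ?thesis
    by (simp only: atLeastAtMost_iff) (metis floor_le_iff floor_of_int floor_mono le_floor_iff of_int_minus)
qed

lemma
  assumes "0 < m" "0 < k" and p: "p \<in> heis_cell m k (a, b, l)"
  defines "w \<equiv> Complex (a / m) (b / m)"
  shows heis_cell_horizontal: "cmod (fst p - w) \<le> 2 / m"
    and heis_cell_vertical: "\<bar>snd p - Im (cnj w * fst p) - l / k\<bar> \<le> 1 / k"
    and heis_cell_unit: "koranyi_norm p \<le> 1"
    and heis_cell_grid_point: "cmod w \<le> 3"
proof -
  have p': "koranyi_norm p \<le> 1" "\<lfloor>m * Re (fst p)\<rfloor> = a" "\<lfloor>m * Im (fst p)\<rfloor> = b"
     "\<lfloor>k * (snd p - Im (cnj w * fst p))\<rfloor> = l"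
    using p by (simp_all add: heis_cell_def w_def koranyi_cball_def)
  show "koranyi_norm p \<le> 1" by fact
  have "\<bar>Re (fst p - w)\<bar> \<le> 1 / m" "\<bar>Im (fst p - w)\<bar> \<le> 1 / m"
    using floor_grid[OF assms(1), of "Re (fst p)"] floor_grid[OF assms(1), of "Im (fst p)"]
    unfolding p' by (simp_all add: w_def)
  then show h: "cmod (fst p - w) \<le> 2 / m"
    using cmod_le[of "fst p - w"] by simp
  show "\<bar>snd p - Im (cnj w * fst p) - l / k\<bar> \<le> 1 / k"
    using floor_grid[OF assms(2), of "snd p - Im (cnj w * fst p)"] unfolding p' by simp
  have "cmod w \<le> cmod (fst p) + cmod (fst p - w)"
    using norm_triangle_ineq4[of "fst p" "fst p - w"] by simp
  moreover have "2 / real m \<le> 2 / 1" using assms(1) by (intro divide_left_mono) auto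
  ultimately show "cmod w \<le> 3"
    using h cmod_fst_le_koranyi_norm[of p] p'(1) by linarith
qed

text \<open>The sheared height that is rounded in \<open>heis_cell\<close>, taken relative to l/k,
  is exactly the vertical coordinate of p seen from the cell centre in the group, so
  \<open>koranyi_norm_le\<close> applies to the cell bounds directly.\<close>

lemma heis_cell_subset_koranyi_cball:
  assumes "0 < m" "0 < k"
  shows "heis_cell m k i \<subseteq> koranyi_cball (heis_cell_center m k i) (2 / m + sqrt (2 / k))"
proof
  obtain a b l where [simp]: "i = (a, b, l)" by (cases i)
  fix p assume "p \<in> heis_cell m k i"
  then have p: "p \<in> heis_cell m k (a, b, l)" by simp
  let ?w = "Complex (a / m) (b / m)" and ?x = "heis_cell_center m k i"
  have x: "?x = (?w, l / k)" by (simp add: heis_cell_center_def)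
  have "heis_mult (heis_inv ?x) p = (fst p - ?w, snd p - Im (cnj ?w * fst p) - l / k)"
    unfolding x by (simp add: heis_mult_def heis_inv_def algebra_simps)
  then have "koranyi_dist p ?x \<le> cmod (fst p - ?w) + sqrt (2 * \<bar>snd p - Im (cnj ?w * fst p) - l / k\<bar>)"
    unfolding koranyi_dist_def using koranyi_norm_le by (metis fst_conv snd_conv)
  also have "\<dots> \<le> 2 / m + sqrt (2 * (1 / k))"
    by (intro add_mono real_sqrt_le_mono mult_left_mono heis_cell_horizontal[OF assms p]
        heis_cell_vertical[OF assms p]) simp
  finally show "p \<in> koranyi_cball ?x (2 / m + sqrt (2 / k))"
    by (simp add: koranyi_cball_def)
qed

lemma bounded_heis_cell: "bounded (heis_cell m k i)"
  by (rule bounded_subset[OF compact_imp_bounded[OF compact_koranyi_unit_cball]])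
    (auto simp: heis_cell_def split: prod.splits)

text \<open>Of the 16/m, 4/m is the horizontal extent and 12/m the effect of the shear, whose slope
  is at most 3; 2/k is the thickness of the cell.\<close>

lemma diameter_heis_cell_le:
  assumes "0 < m" "0 < k"
  shows "diameter (heis_cell m k i) \<le> 16 / m + 2 / k"
proof (rule diameter_le)
  show "heis_cell m k i \<noteq> {} \<or> 0 \<le> 16 / real m + 2 / real k" by simp
  obtain a b l where [simp]: "i = (a, b, l)" by (cases i)
  fix p q assume "p \<in> heis_cell m k i" "q \<in> heis_cell m k i"
  then have p: "p \<in> heis_cell m k (a, b, l)" and q: "q \<in> heis_cell m k (a, b, l)" by simp_all
  let ?w = "Complex (a / m) (b / m)"
  note h = heis_cell_horizontal[OF assms p] heis_cell_horizontal[OF assms q]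
  note v = heis_cell_vertical[OF assms p] heis_cell_vertical[OF assms q]
  have 1: "cmod (fst p - fst q) \<le> 4 / m"
    using h norm_triangle_ineq4[of "fst p - ?w" "fst q - ?w"] by simp
  have "\<bar>Im (cnj ?w * (fst p - fst q))\<bar> \<le> cmod ?w * cmod (fst p - fst q)"
    using abs_Im_le_cmod[of "cnj ?w * (fst p - fst q)"] by (simp only: norm_mult complex_mod_cnj)
  also have "\<dots> \<le> 3 * (4 / m)"
    using heis_cell_grid_point[OF assms p] 1 by (intro mult_mono) auto
  finally have "\<bar>Im (cnj ?w * fst p) - Im (cnj ?w * fst q)\<bar> \<le> 12 / m"
    by (simp add: algebra_simps)
  then have 2: "\<bar>snd p - snd q\<bar> \<le> 12 / m + 2 / k"
    using v by linarith
  have "norm (p - q) \<le> norm (fst p - fst q) + norm (snd p - snd q)"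
    using norm_Pair_le[of "fst p - fst q" "snd p - snd q"] by (simp add: minus_prod_def)
  then show "norm (p - q) \<le> 16 / m + 2 / k" using 1 2 by simp
qed

lemma heis_cell_cover:
  assumes "0 < m" "0 < k"
  shows "koranyi_cball (0, 0) 1 \<subseteq> (\<Union>i\<in>heis_cell_index m k. heis_cell m k i)"
proof
  fix p :: "complex \<times> real" assume p: "p \<in> koranyi_cball (0, 0) 1"
  define a where "a = \<lfloor>m * Re (fst p)\<rfloor>"
  define b where "b = \<lfloor>m * Im (fst p)\<rfloor>"
  define w where "w = Complex (a / m) (b / m)"
  define l where "l = \<lfloor>k * (snd p - Im (cnj w * fst p))\<rfloor>"
  have n: "koranyi_norm p \<le> 1" using p by (simp add: koranyi_cball_def)
  then have u: "cmod (fst p) \<le> 1" using cmod_fst_le_koranyi_norm[of p] by linarith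
  have "(koranyi_norm p)\<^sup>2 \<le> 1" using n by (simp add: power_le_one)
  then have s: "\<bar>snd p\<bar> \<le> 1 / 2" using snd_le_koranyi_norm[of p] by simp
  have ri: "\<bar>Re (fst p)\<bar> \<le> real 1" "\<bar>Im (fst p)\<bar> \<le> real 1"
    using abs_Re_le_cmod[of "fst p"] abs_Im_le_cmod[of "fst p"] u by auto
  have a: "a \<in> {- int m..int m}" and b: "b \<in> {- int m..int m}"
    using floor_grid_bound[OF ri(1), of m] floor_grid_bound[OF ri(2), of m] by (simp_all add: a_def b_def)
  have frac: "\<bar>j / m\<bar> \<le> 1" if "j \<in> {- int m..int m}" for j :: int
  proof -
    have "\<bar>j\<bar> \<le> int m" using that by auto
    then have "\<bar>real_of_int j\<bar> \<le> real m" by linarith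
    then show ?thesis using assms(1) by (simp add: abs_divide)
  qed
  have "cmod w \<le> 2"
    using cmod_le[of w] frac[OF a] frac[OF b] by (simp add: w_def)
  have "\<bar>Im (cnj w * fst p)\<bar> \<le> cmod w * cmod (fst p)"
    using abs_Im_le_cmod[of "cnj w * fst p"] by (simp only: norm_mult complex_mod_cnj)
  also have "\<dots> \<le> 2 * 1" using \<open>cmod w \<le> 2\<close> u by (intro mult_mono) auto
  finally have "\<bar>snd p - Im (cnj w * fst p)\<bar> \<le> real 3" using s by linarith
  then have "l \<in> {- (3 * int k)..3 * int k}"
    using floor_grid_bound[of "snd p - Im (cnj w * fst p)" 3 k] by (simp only: l_def of_nat_numeral)
  then have "(a, b, l) \<in> heis_cell_index m k"
    using a b by (simp add: heis_cell_index_def)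
  moreover have "p \<in> heis_cell m k (a, b, l)"
    using p by (simp add: heis_cell_def a_def b_def l_def w_def)
  ultimately show "p \<in> (\<Union>i\<in>heis_cell_index m k. heis_cell m k i)" by blast
qed

lemma summable_geometric_bound:
  fixes f :: "nat \<Rightarrow> real"
  assumes "\<And>n. 0 \<le> f n" "\<And>n. f n \<le> C * q ^ n" "0 \<le> q" "q < 1"
  shows "summable f"
proof (rule summable_comparison_test')
  show "summable (\<lambda>n. C * q ^ n)"
    using assms(3,4) by (intro summable_mult summable_geometric) simp
  show "norm (f n) \<le> C * q ^ n" for n using assms(1,2)[of n] by simp
qed

context poisson_cutout
begin

text \<open>The cells of side \<open>2\<^sup>-\<^sup>c\<^sup>n\<close> and height \<open>4\<^sup>-\<^sup>n\<close> lie in Koranyi balls of radius about \<open>2\<^sup>-\<^sup>n\<close>: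
  \<open>c = 1\<close> covers these balls by sets of full size, \<open>c = 2\<close> by small Euclidean cubes.\<close>
lemma AE_hausdorff_measure_cutout_eq_0_cells:
  assumes "0 < s" and c: "c = 1 \<or> c = (2::nat)" and s: "(2 * real c + 2 - \<gamma>) / real c < s"
  shows "AE \<omega> in M. hausdorff_measure s (cutout_set (N \<omega>)) = 0"
proof (rule AE_hausdorff_measure_cutout_eq_0[OF \<open>0 < s\<close>])
  let ?m = "\<lambda>n. (2::nat) ^ (c * n)" and ?k = "\<lambda>n. (2::nat) ^ (2 * n)"
  \<comment> \<open>The radius 4 bounds 2/m + sqrt(2/k) in units of 2^-n; the diameter 18 = 16 + 2
    uses 1/k at most 1/m.\<close>
  let ?e = "\<lambda>n. 4 * (1 / 2 ^ n) :: real" and ?\<delta> = "\<lambda>n. 18 * (1 / 2 ^ c) ^ n :: real"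
  have pos: "0 < ?m n" "0 < ?k n" for n by simp_all
  have mk: "2 ^ n \<le> ?m n" "?m n \<le> ?k n" for n
    using c by (auto intro!: power_increasing)
  show "finite (heis_cell_index (?m n) (?k n))" for n by simp
  show "0 < ?e n" "0 < ?\<delta> n" for n by simp_all
  have "(\<lambda>n. (1 / 2 ^ c) ^ n :: real) \<longlonglongrightarrow> 0"
    using c by (intro LIMSEQ_power_zero) auto
  then show "?\<delta> \<longlonglongrightarrow> 0"
    using tendsto_mult_right_zero by blast
  show "koranyi_cball (0, 0) 1 \<subseteq> (\<Union>i\<in>heis_cell_index (?m n) (?k n). heis_cell (?m n) (?k n) i)" for n
    using pos by (rule heis_cell_cover)
  show "bounded (heis_cell (?m n) (?k n) i)" for n i
    by (rule bounded_heis_cell)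
  show "heis_cell (?m n) (?k n) i \<subseteq> koranyi_cball (heis_cell_center (?m n) (?k n) i) (?e n)" for n i
  proof -
    have "2 / real (?m n) \<le> 2 / 2 ^ n"
      using mk(1)[of n] by (intro divide_left_mono) (simp_all flip: of_nat_le_iff)
    moreover have "sqrt (2 / real (?k n)) \<le> 2 / 2 ^ n"
      by (rule real_le_lsqrt) (simp_all add: power_divide power_mult power_mult_distrib[symmetric] power2_eq_square divide_right_mono)
    ultimately have "2 / real (?m n) + sqrt (2 / real (?k n)) \<le> ?e n" by simp
    then show ?thesis
      using heis_cell_subset_koranyi_cball[OF pos, of n n i]
      by (auto simp: koranyi_cball_def intro: order_trans)
  qed
  show "diameter (heis_cell (?m n) (?k n) i) \<le> ?\<delta> n" for n i
  proof -
    have "2 / real (?k n) \<le> 2 / real (?m n)"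
      using mk(2)[of n] by (intro divide_left_mono) (simp_all flip: of_nat_le_iff)
    then have "16 / real (?m n) + 2 / real (?k n) \<le> 18 / real (?m n)" by simp
    also have "\<dots> = ?\<delta> n" by (simp add: power_mult power_one_over)
    finally show ?thesis
      using diameter_heis_cell_le[OF pos, of n n i] by linarith
  qed
  \<comment> \<open>The exponent per stage collects 2c + 2 from the number m^2 k of cells, -\<gamma>
    from the survival probability and -c s from the gauge. It is negative exactly beyond the
    threshold assumed for s.\<close>
  define q where "q = 2 powr (2 * real c + 2 - \<gamma> - real c * s)"
  define C where "C = 63 * (16 * exp 1) powr \<gamma> * 18 powr s"
  have "2 * real c + 2 - \<gamma> - real c * s < 0"
    using s c by (auto simp: field_simps)
  then have "q < 2 powr 0"
    unfolding q_def by (intro powr_less_mono) auto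
  then have q: "0 \<le> q" "q < 1" by (simp_all add: q_def)
  have pw: "(2::real) ^ j = 2 powr (real j)" for j by (simp add: powr_realpow)
  have bound: "real (card (heis_cell_index (?m n) (?k n))) * (4 * exp 1 * ?e n) powr \<gamma> * ?\<delta> n powr s
      \<le> C * q ^ n" for n
  proof -
    have m: "(real (?m n))\<^sup>2 = 2 powr (2 * real c * real n)"
      by (simp add: pw power2_eq_square powr_add[symmetric] mult.assoc)
    have k: "real (?k n) = 2 powr (2 * real n)"
      by (simp add: pw)
    have "4 * exp 1 * ?e n = (16 * exp 1) * 2 powr (- real n)"
      by (simp add: pw powr_minus_divide)
    then have e: "(4 * exp 1 * ?e n) powr \<gamma> = (16 * exp 1) powr \<gamma> * 2 powr (- (real n * \<gamma>))"
      by (simp add: powr_mult powr_powr)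
    have "?\<delta> n = 18 * 2 powr (- (real c * real n))"
      using pw[of "c * n"] by (simp add: powr_minus_divide power_one_over power_mult)
    then have \<delta>: "?\<delta> n powr s = 18 powr s * 2 powr (- (real c * real n * s))"
      by (simp add: powr_mult powr_powr)
    have "real (card (heis_cell_index (?m n) (?k n))) * (4 * exp 1 * ?e n) powr \<gamma> * ?\<delta> n powr s
      \<le> 63 * (real (?m n))\<^sup>2 * real (?k n) * (4 * exp 1 * ?e n) powr \<gamma> * ?\<delta> n powr s"
      using pos by (intro mult_right_mono card_heis_cell_index_le) (auto simp: Suc_le_eq)
    also have "\<dots> = C * (2 powr (2 * real c * real n) * 2 powr (2 * real n)
        * 2 powr (- (real n * \<gamma>)) * 2 powr (- (real c * real n * s)))"
      unfolding m k e \<delta> C_def by (simp only: mult_ac)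
    also have "2 powr (2 * real c * real n) * 2 powr (2 * real n) * 2 powr (- (real n * \<gamma>)) * 2 powr (- (real c * real n * s))
      = 2 powr ((2 * real c + 2 - \<gamma> - real c * s) * real n)"
      unfolding powr_add[symmetric] by (simp add: algebra_simps)
    also have "\<dots> = q ^ n"
      by (simp add: q_def powr_powr[symmetric] powr_realpow)
    finally show ?thesis .
  qed
  show "summable (\<lambda>n. real (card (heis_cell_index (?m n) (?k n))) * (4 * exp 1 * ?e n) powr \<gamma> * ?\<delta> n powr s)"
    by (rule summable_geometric_bound[OF _ bound q]) (intro mult_nonneg_nonneg of_nat_0_le_iff powr_ge_zero)
qed

lemma AE_hausdorff_dim_cutout_le:
  assumes "\<gamma> < 4"
  shows "AE \<omega> in M. hausdorff_dim (cutout_set (N \<omega>)) \<le> min (4 - \<gamma>) (3 - \<gamma> / 2)"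
proof -
  let ?\<alpha> = "min (4 - \<gamma>) (3 - \<gamma> / 2)"
  have "0 < ?\<alpha>" using assms by simp
  \<comment> \<open>A countable sequence of exponents decreasing to the bound keeps the union of the
    exceptional sets null.\<close>
  have "AE \<omega> in M. hausdorff_measure (?\<alpha> + 1 / real (Suc k)) (cutout_set (N \<omega>)) = 0" for k
  proof -
    define h where "h = 1 / real (Suc k)"
    have h: "0 < h" by (simp add: h_def)
    \<comment> \<open>The two values c = 1 and c = 2 give the two entries of the minimum.\<close>
    have "(2 * real 1 + 2 - \<gamma>) / real 1 < ?\<alpha> + h \<or> (2 * real 2 + 2 - \<gamma>) / real 2 < ?\<alpha> + h"
      using h by (auto simp: min_def field_simps)
    then show ?thesis
      using \<open>0 < ?\<alpha>\<close> h unfolding h_def[symmetric]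
      by (metis AE_hausdorff_measure_cutout_eq_0_cells add_pos_pos)
  qed
  then have "AE \<omega> in M. \<forall>k. hausdorff_measure (?\<alpha> + 1 / real (Suc k)) (cutout_set (N \<omega>)) = 0"
    by (simp add: AE_all_countable)
  then show ?thesis
  proof eventually_elim
    case (elim \<omega>)
    let ?E = "cutout_set (N \<omega>)"
    have "hausdorff_dim ?E \<le> ?\<alpha> + 1 / real (Suc k)" for k
      unfolding hausdorff_dim_def using elim \<open>0 < ?\<alpha>\<close>
      by (intro cInf_lower) (auto intro!: bdd_belowI[of _ 0] add_nonneg_nonneg)
    moreover have "(\<lambda>k. ?\<alpha> + 1 / real (Suc k)) \<longlonglongrightarrow> ?\<alpha> + 0"
      by (intro tendsto_intros lim_1_over_n[THEN LIMSEQ_Suc])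
    ultimately show ?case
      by (intro LIMSEQ_le_const[of "\<lambda>k. ?\<alpha> + 1 / real (Suc k)"]) auto
  qed
qed

end

section \<open>Energies\<close>

text \<open>The value on the diagonal is \<open>\<infinity>\<close>, so that no null sets have to be removed in pointwise estimates
  (\<open>0 powr -s\<close> would be \<open>0\<close>).\<close>
definition riesz :: "real \<Rightarrow> 'a::metric_space \<Rightarrow> 'a \<Rightarrow> ennreal" where
  "riesz s x y = (if dist x y = 0 then \<infinity> else ennreal (dist x y powr - s))"

lemma borel_measurable_riesz [measurable]:
  fixes f g :: "_ \<Rightarrow> 'a::{metric_space, second_countable_topology}"
  assumes [measurable]: "f \<in> borel_measurable M" "g \<in> borel_measurable M"
  shows "(\<lambda>x. riesz s (f x) (g x)) \<in> borel_measurable M"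
  unfolding riesz_def by measurable

lemma riesz_0_ge: "1 \<le> riesz 0 x y"
  by (auto simp: riesz_def)

lemma riesz_ge:
  assumes "0 \<le> s" "0 < d" "dist x y \<le> d"
  shows "1 \<le> ennreal (d powr s) * riesz s x y"
proof (cases "dist x y = 0")
  case True
  then show ?thesis using assms(2) by (simp add: riesz_def ennreal_mult_top)
next
  case False
  then have "0 < dist x y" by simp
  then have "1 = dist x y powr s * dist x y powr - s"
    by (simp add: powr_add[symmetric] del: zero_less_dist_iff)
  also have "\<dots> \<le> d powr s * dist x y powr - s"
    using assms by (intro mult_right_mono powr_mono2) auto
  finally have "1 \<le> ennreal (d powr s * dist x y powr - s)"
    by (metis ennreal_1 ennreal_leI)
  with False show ?thesis by (simp add: riesz_def ennreal_mult)
qed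

text \<open>Points of large potential carry at most half of the mass; on the rest, the mass of a set of
  diameter at most \<open>d\<close> is \<open>O(d\<^sup>s)\<close>.\<close>
lemma energy_cover_bound:
  fixes \<mu> :: "'a::{metric_space, second_countable_topology} measure" and k :: "'a \<Rightarrow> 'a \<Rightarrow> ennreal"
  assumes sets [measurable_cong]: "sets \<mu> = sets borel" and "sigma_finite_measure \<mu>"
    and k [measurable]: "case_prod k \<in> borel_measurable (borel \<Otimes>\<^sub>M borel)"
    and ck: "\<And>x y. ennreal c * riesz s x y \<le> k x y" and pos: "0 < c" "0 \<le> s" "0 < m" "0 < L"
    and mass: "ennreal m \<le> emeasure \<mu> UNIV"
    and energy: "(\<integral>\<^sup>+x. \<integral>\<^sup>+y. k x y \<partial>\<mu> \<partial>\<mu>) \<le> ennreal L"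
    and V: "\<And>i::nat. V i \<in> sets borel" "AE x in \<mu>. x \<in> (\<Union>i. V i)"
    and d: "\<And>i. 0 < d i" "\<And>i x y. x \<in> V i \<Longrightarrow> y \<in> V i \<Longrightarrow> dist x y \<le> d i"
  shows "ennreal (m\<^sup>2 * c / (4 * L)) \<le> (\<Sum>i. ennreal (d i powr s))"
proof -
  interpret sigma_finite_measure \<mu> by fact
  have space [simp]: "space \<mu> = UNIV" using sets_eq_imp_space_eq[OF sets] by simp
  define P where "P x = (\<integral>\<^sup>+y. k x y \<partial>\<mu>)" for x
  have [measurable]: "P \<in> borel_measurable borel"
    unfolding P_def by measurable
  \<comment> \<open>By Markov's inequality the points of potential above 2L/m carry mass at most
    m/2. The remaining m/2, multiplied by c/L', produces the constant m^2 c / (4L).\<close>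
  define L' where "L' = 2 * L / m"
  have "0 < L'" using pos by (simp add: L'_def)
  define G where "G = {x. P x \<le> ennreal L'}"
  have G [measurable]: "G \<in> sets borel" "- G \<in> sets borel"
    unfolding G_def by (simp_all flip: Collect_neg_eq)
  have "ennreal L' * emeasure \<mu> (- G) = (\<integral>\<^sup>+x. ennreal L' * indicator (- G) x \<partial>\<mu>)"
    using G by (simp add: nn_integral_cmult)
  also have "\<dots> \<le> (\<integral>\<^sup>+x. P x \<partial>\<mu>)"
    by (intro nn_integral_mono) (auto simp: G_def indicator_def not_le less_imp_le)
  also have "\<dots> \<le> ennreal L" using energy by (simp add: P_def)
  finally have "ennreal (1 / L') * (ennreal L' * emeasure \<mu> (- G)) \<le> ennreal (1 / L') * ennreal L"
    by (intro mult_left_mono) auto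
  then have "emeasure \<mu> (- G) \<le> ennreal (m / 2)"
    using \<open>0 < L'\<close> pos by (simp add: mult.assoc[symmetric] ennreal_mult'[symmetric] L'_def)
  moreover have "emeasure \<mu> UNIV = emeasure \<mu> G + emeasure \<mu> (- G)"
    using G by (subst plus_emeasure) (auto simp: sets)
  moreover have "ennreal m = ennreal (m / 2) + ennreal (m / 2)"
    using pos by (simp flip: ennreal_plus)
  ultimately have "ennreal (m / 2) + ennreal (m / 2) \<le> ennreal (m / 2) + emeasure \<mu> G"
    using mass by (metis add.commute add_left_mono order_trans)
  then have "ennreal (m / 2) \<le> emeasure \<mu> G"
    by (simp add: ennreal_add_left_cancel_le)
  also have "\<dots> \<le> emeasure \<mu> (\<Union>i. G \<inter> V i)"
    using V G by (intro emeasure_mono_AE) (auto simp: sets)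
  also have "\<dots> \<le> (\<Sum>i. emeasure \<mu> (G \<inter> V i))"
    using V G by (intro emeasure_subadditive_countably) (auto simp: sets)
  also have "\<dots> \<le> (\<Sum>i. ennreal (L' / c) * ennreal (d i powr s))"
  proof (intro suminf_le)
    fix i
    show "emeasure \<mu> (G \<inter> V i) \<le> ennreal (L' / c) * ennreal (d i powr s)"
    proof (cases "G \<inter> V i = {}")
      case False
      \<comment> \<open>The potential at one single good point of \<open>V i\<close> already bounds
        the mass of all of \<open>G \<inter> V i\<close>.\<close>
      then obtain x where x: "P x \<le> ennreal L'" "x \<in> V i" by (auto simp: G_def)
      have [measurable]: "k x \<in> borel_measurable borel" by measurable
      have "emeasure \<mu> (G \<inter> V i) \<le> (\<integral>\<^sup>+y. indicator (V i) y \<partial>\<mu>)"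
        using V(1)[of i] by (simp add: sets emeasure_mono)
      also have "\<dots> \<le> (\<integral>\<^sup>+y. ennreal (d i powr s / c) * k x y \<partial>\<mu>)"
      proof (intro nn_integral_mono)
        fix y
        show "indicator (V i) y \<le> ennreal (d i powr s / c) * k x y"
        proof (cases "y \<in> V i")
          case True
          have "1 \<le> ennreal (d i powr s) * riesz s x y"
            using pos(2) d(1) d(2)[OF x(2) True] by (rule riesz_ge)
          also have "ennreal (d i powr s) = ennreal (d i powr s / c) * ennreal c"
            using pos(1) by (simp flip: ennreal_mult')
          also have "\<dots> * riesz s x y \<le> ennreal (d i powr s / c) * k x y"
            unfolding mult.assoc by (intro mult_left_mono ck) simp
          finally show ?thesis using True by simp
        qed simp
      qed
      also have "\<dots> = ennreal (d i powr s / c) * P x"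
        unfolding P_def by (rule nn_integral_cmult) measurable
      also have "\<dots> \<le> ennreal (d i powr s / c) * ennreal L'"
        by (intro mult_left_mono x) simp
      also have "\<dots> = ennreal (L' / c) * ennreal (d i powr s)"
        using pos \<open>0 < L'\<close> by (simp add: ennreal_mult'[symmetric] mult.commute)
      finally show ?thesis .
    qed simp
  qed auto
  also have "\<dots> = ennreal (L' / c) * (\<Sum>i. ennreal (d i powr s))"
    by simp
  finally have "ennreal (c / L') * ennreal (m / 2)
      \<le> ennreal (c / L') * (ennreal (L' / c) * (\<Sum>i. ennreal (d i powr s)))"
    by (intro mult_left_mono) auto
  also have "\<dots> = (\<Sum>i. ennreal (d i powr s))"
    using pos \<open>0 < L'\<close> by (simp add: mult.assoc[symmetric] ennreal_mult'[symmetric])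
  finally show ?thesis
    using pos by (simp add: ennreal_mult'[symmetric] L'_def power2_eq_square mult_ac)
qed

text \<open>One-variable model singularity. The value at 0 matches that of \<open>riesz\<close> on
  the diagonal; the window contains every coordinate of a group difference of two points of the unit
  ball.\<close>

definition abs_powr_weight :: "real \<Rightarrow> real \<Rightarrow> ennreal" where
  "abs_powr_weight c x = (if x = 0 then \<infinity> else ennreal (\<bar>x\<bar> powr - c) * indicator {-2..2} x)"

lemma borel_measurable_abs_powr_weight [measurable]:
  assumes [measurable]: "f \<in> borel_measurable M"
  shows "(\<lambda>x. abs_powr_weight c (f x)) \<in> borel_measurable M"
  unfolding abs_powr_weight_def by measurable

lemma nn_integral_abs_powr_weight_finite:
  assumes "0 \<le> c" "c < 1"
  shows "(\<integral>\<^sup>+x. abs_powr_weight c x \<partial>lborel) < \<infinity>"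
proof -
  define g where "g x = x powr - c * indicator {0..2} x" for x :: real
  have [measurable]: "g \<in> borel_measurable borel" unfolding g_def by measurable
  have "((\<lambda>x. x powr - c) has_integral (2 powr (- c + 1) / (- c + 1))) {0..2}"
    using assms by (intro has_integral_powr_from_0) auto
  then have "(g has_integral (2 powr (- c + 1) / (- c + 1))) UNIV"
    unfolding g_def has_integral_restrict_UNIV[symmetric, where s = "{0..2}"]
    by (rule has_integral_eq[rotated]) (simp add: indicator_def)
  then have g: "(\<integral>\<^sup>+x. ennreal (g x) \<partial>lborel) < \<infinity>"
    by (subst nn_integral_has_integral_lborel) (auto simp: g_def)
  have "(\<integral>\<^sup>+x. abs_powr_weight c x \<partial>lborel) \<le> (\<integral>\<^sup>+x. ennreal (g x) + ennreal (g (- x)) \<partial>lborel)"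
    by (rule nn_integral_mono_AE, use AE_lborel_singleton[of "0::real"] in eventually_elim)
      (auto simp: abs_powr_weight_def g_def indicator_def abs_if)
  also have "\<dots> = (\<integral>\<^sup>+x. ennreal (g x) \<partial>lborel) + (\<integral>\<^sup>+x. ennreal (g (- x)) \<partial>lborel)"
    by (rule nn_integral_add) measurable
  also have "(\<integral>\<^sup>+x. ennreal (g (- x)) \<partial>lborel) = (\<integral>\<^sup>+x. ennreal (g x) \<partial>lborel)"
    using nn_integral_real_affine[of "\<lambda>x. ennreal (g x)" "-1" 0] by simp
  finally show ?thesis using g by (simp add: ennreal_add_less_top order_le_less_trans)
qed

text \<open>The planar factor |v|^-a is replaced by the larger product of |Re v|^(-a/2) and |Im
  v|^(-a/2). The integral then splits into one-dimensional ones, still under the natural condition a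
  < 2.\<close>

definition heis_weight :: "real \<Rightarrow> real \<Rightarrow> complex \<times> real \<Rightarrow> ennreal" where
  "heis_weight a b p = abs_powr_weight (a / 2) (Re (fst p)) * abs_powr_weight (a / 2) (Im (fst p))
     * abs_powr_weight b (snd p)"

lemma borel_measurable_heis_weight [measurable]: "heis_weight a b \<in> borel_measurable borel"
proof -
  have "heis_weight a b \<in> borel_measurable (borel \<Otimes>\<^sub>M borel)"
    unfolding heis_weight_def by measurable
  then show ?thesis by (simp only: borel_prod)
qed

lemma nn_integral_heis_weight_finite:
  assumes "0 \<le> a" "a < 2" "0 \<le> b" "b < 1"
  shows "(\<integral>\<^sup>+p. heis_weight a b p \<partial>lborel) < \<infinity>"
proof -
  let ?A = "\<integral>\<^sup>+x. abs_powr_weight (a / 2) x \<partial>lborel" and ?B = "\<integral>\<^sup>+x. abs_powr_weight b x \<partial>lborel"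
  have "(\<integral>\<^sup>+p. heis_weight a b p \<partial>lborel)
      = (\<integral>\<^sup>+u. abs_powr_weight (a / 2) (Re u) * abs_powr_weight (a / 2) (Im u) * ?B \<partial>lborel)"
    by (subst nn_integral_lborel_prod) (simp_all add: heis_weight_def nn_integral_cmult)
  also have "\<dots> = (\<integral>\<^sup>+x. \<integral>\<^sup>+y. abs_powr_weight (a / 2) x * abs_powr_weight (a / 2) y * ?B \<partial>lborel \<partial>lborel)"
    by (subst nn_integral_lborel_complex) simp_all
  also have "\<dots> = ?A * ?A * ?B"
    by (simp add: nn_integral_cmult nn_integral_multc)
  also have "\<dots> < \<infinity>"
    using nn_integral_abs_powr_weight_finite[of "a / 2"] nn_integral_abs_powr_weight_finite[of b] assms
    by (simp add: ennreal_mult_less_top)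
  finally show ?thesis .
qed

text \<open>The homogeneous norm dominates \<open>|v|\<close> and \<open>|t|\<^sup>1\<^sup>/\<^sup>2\<close>, the Euclidean distance dominates \<open>|v|\<close> and
  \<open>|t|\<close>; splitting the exponents \<open>\<gamma> = (\<gamma> - p) + p\<close> and \<open>s = (s - \<sigma>) + \<sigma>\<close> separates the variables.\<close>
lemma kernel_le_heis_weight:
  assumes x: "cmod (fst x) \<le> 1" and n: "koranyi_norm q \<le> 2"
    and ex: "0 \<le> p" "p \<le> \<gamma>" "0 \<le> \<sigma>" "\<sigma> \<le> s"
  shows "ennreal (koranyi_norm q powr - \<gamma>) * riesz s x (heis_mult x q)
    \<le> ennreal (2 powr s) * heis_weight (\<gamma> + s - p - \<sigma>) (p / 2 + \<sigma>) q"
proof (cases "Re (fst q) = 0 \<or> Im (fst q) = 0 \<or> snd q = 0")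
  case True
  have "cmod (fst q) \<le> 2" using cmod_fst_le_koranyi_norm[of q] n by linarith
  then have 1: "\<bar>Re (fst q)\<bar> \<le> 2" "\<bar>Im (fst q)\<bar> \<le> 2"
    using abs_Re_le_cmod[of "fst q"] abs_Im_le_cmod[of "fst q"] by auto
  have "(koranyi_norm q)\<^sup>2 \<le> 2\<^sup>2" using n by (intro power_mono) auto
  then have 2: "\<bar>snd q\<bar> \<le> 2" using snd_le_koranyi_norm[of q] by simp
  \<comment> \<open>Infinity times 0 is 0 in \<open>ennreal\<close>, so an infinite factor makes the
    weight infinite only once the other factors are known to be nonzero.\<close>
  have nz: "abs_powr_weight c y \<noteq> 0" if "\<bar>y\<bar> \<le> 2" for c y
    using that by (auto simp: abs_powr_weight_def indicator_def abs_le_iff)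
  have "heis_weight a b q = \<infinity>" for a b
    using True nz[OF 1(1)] nz[OF 1(2)] nz[OF 2]
    unfolding heis_weight_def by (auto simp: abs_powr_weight_def[of _ 0] ennreal_mult_eq_top_iff)
  then show ?thesis by (simp add: ennreal_mult_top)
next
  case False
  define v where "v = cmod (fst q)"
  define t where "t = \<bar>snd q\<bar>"
  define D where "D = dist x (heis_mult x q)"
  define K where "K = koranyi_norm q"
  let ?a = "\<gamma> + s - p - \<sigma>"
  have vri: "\<bar>Re (fst q)\<bar> \<le> v" "\<bar>Im (fst q)\<bar> \<le> v"
    unfolding v_def by (rule abs_Re_le_cmod abs_Im_le_cmod)+
  have pos: "0 < \<bar>Re (fst q)\<bar>" "0 < \<bar>Im (fst q)\<bar>" "0 < t" using False by (auto simp: t_def)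
  then have "0 < v" using vri by linarith
  have vK: "v \<le> K" unfolding v_def K_def by (rule cmod_fst_le_koranyi_norm)
  have "K\<^sup>2 \<le> 2\<^sup>2" unfolding K_def using n by (intro power_mono) auto
  then have t2: "t \<le> 2" using snd_le_koranyi_norm[of q] by (simp add: t_def K_def)
  have "t \<le> K\<^sup>2" using snd_le_koranyi_norm[of q] by (simp add: t_def K_def)
  then have tK: "t powr (1 / 2) \<le> K"
    using pos by (simp add: powr_half_sqrt K_def real_le_lsqrt)
  have D: "v / 2 \<le> D" "t / 2 \<le> D"
    using dist_heis_mult_ge[OF x, of q] by (simp_all add: v_def t_def D_def)
  have "0 < K" "0 < D" using vK D \<open>0 < v\<close> by linarith+
  have "K powr - \<gamma> = K powr (- (\<gamma> - p)) * K powr (- p)"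
    by (simp add: powr_add[symmetric])
  also have "\<dots> \<le> v powr (- (\<gamma> - p)) * (t powr (1 / 2)) powr (- p)"
    using vK tK ex pos \<open>0 < v\<close> by (intro mult_mono powr_mono2') auto
  also have "\<dots> = v powr (- (\<gamma> - p)) * t powr (- (p / 2))"
    by (simp add: powr_powr)
  finally have 1: "K powr - \<gamma> \<le> v powr (- (\<gamma> - p)) * t powr (- (p / 2))" .
  have "D powr - s = D powr (- (s - \<sigma>)) * D powr (- \<sigma>)"
    by (simp add: powr_add[symmetric])
  also have "\<dots> \<le> (v / 2) powr (- (s - \<sigma>)) * (t / 2) powr (- \<sigma>)"
    using D ex pos \<open>0 < v\<close> by (intro mult_mono powr_mono2') auto
  also have "\<dots> = 2 powr s * (v powr (- (s - \<sigma>)) * t powr (- \<sigma>))"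
  proof -
    have "(v / 2) powr (- (s - \<sigma>)) = v powr (- (s - \<sigma>)) * 2 powr (s - \<sigma>)"
      "(t / 2) powr (- \<sigma>) = t powr (- \<sigma>) * 2 powr \<sigma>"
      using \<open>0 < v\<close> pos by (simp_all add: powr_divide powr_minus_divide powr_diff)
    moreover have "2 powr (s - \<sigma>) * 2 powr \<sigma> = (2::real) powr s"
      by (simp add: powr_add[symmetric])
    ultimately show ?thesis by (simp add: algebra_simps)
  qed
  finally have 2: "D powr - s \<le> 2 powr s * (v powr (- (s - \<sigma>)) * t powr (- \<sigma>))" .
  have "v powr (- ?a) = v powr (- (?a / 2)) * v powr (- (?a / 2))"
    by (simp add: powr_add[symmetric])
  also have "\<dots> \<le> \<bar>Re (fst q)\<bar> powr (- (?a / 2)) * \<bar>Im (fst q)\<bar> powr (- (?a / 2))"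
    using vri pos ex by (intro mult_mono powr_mono2') auto
  finally have 3: "v powr (- ?a) \<le> \<bar>Re (fst q)\<bar> powr (- (?a / 2)) * \<bar>Im (fst q)\<bar> powr (- (?a / 2))" .
  have "K powr - \<gamma> * D powr - s
      \<le> (v powr (- (\<gamma> - p)) * t powr (- (p / 2))) * (2 powr s * (v powr (- (s - \<sigma>)) * t powr (- \<sigma>)))"
    using 1 2 by (intro mult_mono) auto
  also have "\<dots> = 2 powr s * ((v powr (- (\<gamma> - p)) * v powr (- (s - \<sigma>))) * (t powr (- (p / 2)) * t powr (- \<sigma>)))"
    by (simp only: mult_ac)
  also have "\<dots> = 2 powr s * (v powr (- ?a) * t powr (- (p / 2 + \<sigma>)))"
    by (simp add: powr_add[symmetric] algebra_simps)
  also have "\<dots> \<le> 2 powr s * (\<bar>Re (fst q)\<bar> powr (- (?a / 2)) * \<bar>Im (fst q)\<bar> powr (- (?a / 2)) * t powr (- (p / 2 + \<sigma>)))"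
    using 3 by (intro mult_left_mono mult_right_mono) auto
  finally have "ennreal (K powr - \<gamma> * D powr - s) \<le> ennreal (2 powr s *
      (\<bar>Re (fst q)\<bar> powr (- (?a / 2)) * \<bar>Im (fst q)\<bar> powr (- (?a / 2)) * t powr (- (p / 2 + \<sigma>))))"
    by (rule ennreal_leI)
  moreover have "ennreal (K powr - \<gamma>) * riesz s x (heis_mult x q) = ennreal (K powr - \<gamma> * D powr - s)"
    using \<open>0 < D\<close> by (simp add: riesz_def D_def ennreal_mult)
  moreover have "abs_powr_weight c y = ennreal (\<bar>y\<bar> powr - c)" if "y \<noteq> 0" "\<bar>y\<bar> \<le> 2" for c y
    using that by (simp add: abs_powr_weight_def abs_le_iff indicator_def)
  ultimately show ?thesis
    using False vri t2 vK n by (simp add: heis_weight_def ennreal_mult t_def K_def)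
qed

text \<open>Moving p from the horizontal to the vertical variable costs only p/2 through the Koranyi
  norm, while moving \<sigma> through the Euclidean distance costs \<sigma> in full. So p is used
  first. With \<sigma> = 0 one needs p between \<gamma> + s - 2 and 2, hence s < 4 - \<gamma>; once
  p = \<gamma> is exhausted, \<sigma> has to lie between s - 2 and 1 - \<gamma>/2, hence s < 3 -
  \<gamma>/2. The nontrivial witnesses are midpoints of these intervals.\<close>

lemma split_exponents:
  fixes \<gamma> s :: real
  assumes "0 < \<gamma>" "\<gamma> < 4" "0 \<le> s" "s < min (4 - \<gamma>) (3 - \<gamma> / 2)"
  obtains p \<sigma> where "0 \<le> p" "p \<le> \<gamma>" "0 \<le> \<sigma>" "\<sigma> \<le> s" "\<gamma> + s - p - \<sigma> < 2" "p / 2 + \<sigma> < 1"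
proof (cases "\<gamma> < 2")
  case True
  show thesis
  proof (cases "s < 2")
    case True
    with \<open>\<gamma> < 2\<close> assms show thesis by (intro that[of \<gamma> 0]) auto
  next
    case False
    with True assms show thesis by (intro that[of \<gamma> "(s - 2 + (1 - \<gamma> / 2)) / 2"]) (auto simp: field_simps)
  qed
next
  case False
  show thesis
  proof (cases "\<gamma> + s < 2")
    case True
    with assms show thesis by (intro that[of 0 0]) auto
  next
    case 2: False
    with False assms show thesis by (intro that[of "(\<gamma> + s - 2 + 2) / 2" 0]) (auto simp: field_simps)
  qed
qed

text \<open>After translation to x the Koranyi factor depends on q alone. The Euclidean factor still
  depends on x, but the majorant \<open>heis_weight\<close> does not, which makes the bound uniform
  in x.\<close>

lemma nn_integral_kernel_bound:
  fixes \<gamma> s :: real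
  assumes "0 < \<gamma>" "\<gamma> < 4" "0 \<le> s" "s < min (4 - \<gamma>) (3 - \<gamma> / 2)"
  obtains J where "0 \<le> J" "\<And>x. x \<in> koranyi_cball (0, 0) 1 \<Longrightarrow>
    (\<integral>\<^sup>+y. indicator (koranyi_cball (0, 0) 1) y * (ennreal (koranyi_dist x y powr - \<gamma>) * riesz s x y) \<partial>lborel)
      \<le> ennreal J"
proof -
  obtain p \<sigma> where ps: "0 \<le> p" "p \<le> \<gamma>" "0 \<le> \<sigma>" "\<sigma> \<le> s" "\<gamma> + s - p - \<sigma> < 2" "p / 2 + \<sigma> < 1"
    using split_exponents[OF assms] by metis
  let ?W = "heis_weight (\<gamma> + s - p - \<sigma>) (p / 2 + \<sigma>)"
  have fin: "ennreal (2 powr s) * (\<integral>\<^sup>+q. ?W q \<partial>lborel) < \<infinity>"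
    using nn_integral_heis_weight_finite[of "\<gamma> + s - p - \<sigma>" "p / 2 + \<sigma>"] ps
    by (simp add: ennreal_mult_less_top)
  define J where "J = enn2real (ennreal (2 powr s) * (\<integral>\<^sup>+q. ?W q \<partial>lborel))"
  show thesis
  proof
    show "0 \<le> J" by (simp add: J_def)
    fix x assume x: "x \<in> koranyi_cball (0, 0) 1"
    let ?\<Omega> = "koranyi_cball (0::complex, 0::real) 1"
    have [measurable]: "?\<Omega> \<in> sets borel" by (intro borel_closed) simp
    have x1: "koranyi_norm x \<le> 1" using x by (simp add: koranyi_cball_def)
    then have u: "cmod (fst x) \<le> 1" using cmod_fst_le_koranyi_norm[of x] by linarith
    have "(\<integral>\<^sup>+y. indicator ?\<Omega> y * (ennreal (koranyi_dist x y powr - \<gamma>) * riesz s x y) \<partial>lborel)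
      = (\<integral>\<^sup>+q. indicator ?\<Omega> (heis_mult x q) *
          (ennreal (koranyi_dist x (heis_mult x q) powr - \<gamma>) * riesz s x (heis_mult x q)) \<partial>lborel)"
      by (rule nn_integral_heis_translate[symmetric]) measurable
    also have "\<dots> \<le> (\<integral>\<^sup>+q. ennreal (2 powr s) * ?W q \<partial>lborel)"
    proof (intro nn_integral_mono)
      fix q
      show "indicator ?\<Omega> (heis_mult x q) *
          (ennreal (koranyi_dist x (heis_mult x q) powr - \<gamma>) * riesz s x (heis_mult x q))
        \<le> ennreal (2 powr s) * ?W q"
      proof (cases "heis_mult x q \<in> ?\<Omega>")
        case True
        then have "koranyi_norm q \<le> 2"
          using koranyi_dist_triangle[of x "heis_mult x q" "(0, 0)"] x1
          by (simp add: koranyi_cball_def)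
        from kernel_le_heis_weight[OF u this ps(1-4)] True show ?thesis by simp
      qed simp
    qed
    also have "\<dots> = ennreal J"
      using fin by (simp add: J_def nn_integral_cmult)
    finally show "(\<integral>\<^sup>+y. indicator ?\<Omega> y * (ennreal (koranyi_dist x y powr - \<gamma>) * riesz s x y) \<partial>lborel)
      \<le> ennreal J" .
  qed
qed

section \<open>The lower bound\<close>

lemma koranyi_dist_pos: "x \<noteq> y \<Longrightarrow> 0 < koranyi_dist x y"
proof (rule ccontr)
  assume ne: "x \<noteq> y" and "\<not> 0 < koranyi_dist x y"
  then have 0: "koranyi_norm (heis_mult (heis_inv y) x) = 0"
    by (metis koranyi_dist_def koranyi_norm_nonneg order_le_less)
  let ?q = "heis_mult (heis_inv y) x"
  have "fst ?q = 0" "snd ?q = 0"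
    using cmod_fst_le_koranyi_norm[of ?q] snd_le_koranyi_norm[of ?q] unfolding 0 by auto
  then have "x = y"
    by (auto simp: heis_mult_def heis_inv_def prod_eq_iff)
  with ne show False by simp
qed

text \<open>A neighbourhood of radius \<rho> increases the diameter by at most 2\<rho>, and the
  power s > 0 is continuous there, also at diameter 0. Openness is for the compactness argument; a
  positive d is for the energy bound, where a singleton would give 0.\<close>

lemma open_enlargement:
  fixes U :: "'a::metric_space set"
  assumes "bounded U" "0 < s" "0 < \<eta>"
  obtains V d where "open V" "U \<subseteq> V" "0 < d" "\<And>x y. x \<in> V \<Longrightarrow> y \<in> V \<Longrightarrow> dist x y \<le> d"
    "d powr s \<le> hd_gauge s U + \<eta>"
proof -
  let ?D = "diameter U"
  have D: "0 \<le> ?D" by (rule diameter_ge_0[OF assms(1)])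
  have gauge: "hd_gauge s U = ?D powr s"
    using assms(2) by (simp add: hd_gauge_def)
  have "((\<lambda>\<rho>. (?D + 2 * \<rho>) powr s) \<longlongrightarrow> (?D + 2 * 0) powr s) (at_right 0)"
    using assms(2) D
    by (intro tendsto_powr' tendsto_intros) (auto simp: eventually_at_filter intro!: always_eventually)
  then have "\<forall>\<^sub>F \<rho> in at_right 0. (?D + 2 * \<rho>) powr s < ?D powr s + \<eta>"
    using assms(3) by (intro order_tendstoD) auto
  moreover have "\<forall>\<^sub>F \<rho> in at_right 0. (0::real) < \<rho>"
    by (rule eventually_at_right_less)
  ultimately obtain \<rho> where \<rho>: "(?D + 2 * \<rho>) powr s < ?D powr s + \<eta>" "0 < \<rho>"
    using eventually_happens'[OF trivial_limit_at_right_real eventually_conj] by blast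
  show thesis
  proof
    show "open (\<Union>x\<in>U. ball x \<rho>)" by (intro open_UN) auto
    show "U \<subseteq> (\<Union>x\<in>U. ball x \<rho>)" using \<rho>(2) by force
    show "0 < ?D + 2 * \<rho>" using D \<rho>(2) by simp
    show "(?D + 2 * \<rho>) powr s \<le> hd_gauge s U + \<eta>" using \<rho>(1) gauge by simp
    fix x y assume "x \<in> (\<Union>x\<in>U. ball x \<rho>)" "y \<in> (\<Union>x\<in>U. ball x \<rho>)"
    then obtain x' y' where xy: "x' \<in> U" "y' \<in> U" "dist x' x < \<rho>" "dist y' y < \<rho>" by auto
    have "dist x y \<le> dist x' x + dist x' y' + dist y' y"
      using dist_triangle[of x y x'] dist_triangle[of x' y y'] by (simp add: dist_commute)
    also have "dist x' y' \<le> ?D" using diameter_bounded_bound[OF assms(1) xy(1,2)] .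
    finally show "dist x y \<le> ?D + 2 * \<rho>" using xy by simp
  qed
qed

lemma compact_decseq_subset_open:
  fixes F :: "nat \<Rightarrow> 'a::heine_borel set"
  assumes "\<And>n. compact (F n)" "\<And>m n. m \<le> n \<Longrightarrow> F n \<subseteq> F m" "open W" "(\<Inter>n. F n) \<subseteq> W"
  obtains n where "F n \<subseteq> W"
proof (rule ccontr)
  assume "\<not> thesis"
  then have "F n - W \<noteq> {}" for n using that by blast
  moreover have "compact (F n - W)" for n using assms(1,3) by (rule compact_diff)
  moreover have "F n - W \<subseteq> F m - W" if "m \<le> n" for m n using assms(2)[OF that] by blast
  ultimately have "\<Inter>(range (\<lambda>n. F n - W)) \<noteq> {}" by (intro compact_nest)
  then obtain x where "\<And>n. x \<in> F n - W" by blast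
  with assms(4) show False by blast
qed

section \<open>Positive Hausdorff measure from mass and energy of the levels\<close>

context poisson_cutout
begin

text \<open>For 0 < e < 1 the factor is the reciprocal of the survival probability, so the expected
  density is 1 at each point of the unit ball.\<close>

definition level_density :: "real \<Rightarrow> 'w \<Rightarrow> complex \<times> real \<Rightarrow> ennreal" where
  "level_density e \<omega> x = ennreal (e powr - \<gamma>) * indicator (level e \<omega>) x"

lemma borel_measurable_level_density [measurable]:
  assumes "0 < e" and [measurable]: "f \<in> measurable A M" "g \<in> borel_measurable A"
  shows "(\<lambda>x. level_density e (f x) (g x)) \<in> borel_measurable A"
  unfolding level_density_def using assms(1) by measurable

text \<open>A cheap open cover contains all levels from some index on, and that index depends on the
  cover. This is why good mass and energy are required at arbitrarily late levels: one of them
  contradicts \<open>energy_cover_bound\<close>.\<close>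

lemma hausdorff_measure_cutout_pos:
  fixes k :: "complex \<times> real \<Rightarrow> complex \<times> real \<Rightarrow> ennreal" and e :: "nat \<Rightarrow> real"
  assumes \<omega>: "\<omega> \<in> space M"
    and k [measurable]: "case_prod k \<in> borel_measurable (borel \<Otimes>\<^sub>M borel)"
    and ck: "\<And>x y. ennreal c * riesz s x y \<le> k x y" and pos: "0 < c" "0 < s" "0 < m" "0 < L"
    and inf: "\<And>n0. \<exists>n\<ge>n0::nat. ennreal m \<le> (\<integral>\<^sup>+x. level_density (1 / (n + 2)) \<omega> x \<partial>lborel) \<and>
      (\<integral>\<^sup>+x. \<integral>\<^sup>+y. level_density (1 / (n + 2)) \<omega> x * (level_density (1 / (n + 2)) \<omega> y * k x y) \<partial>lborel \<partial>lborel)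
        \<le> ennreal L"
  shows "hausdorff_measure s (cutout_set (N \<omega>)) \<noteq> 0"
proof
  assume H0: "hausdorff_measure s (cutout_set (N \<omega>)) = 0"
  \<comment> \<open>A quarter of the bound to be contradicted: the cover costs less than \<eta> and
    its enlargements add the geometric sum 2\<eta>, in total less than 4\<eta>.\<close>
  define \<eta> where "\<eta> = m\<^sup>2 * c / (4 * L) / 4"
  have "0 < \<eta>" using pos by (simp add: \<eta>_def)
  obtain U :: "nat \<Rightarrow> (complex \<times> real) set" where U: "cutout_set (N \<omega>) \<subseteq> (\<Union>i. U i)"
    "\<And>i. bounded (U i)" "\<And>i. diameter (U i) \<le> 1" "(\<Sum>i. ennreal (hd_gauge s (U i))) < ennreal \<eta>"
    by (rule hausdorff_measure_eq_0D[OF H0 zero_less_one \<open>0 < \<eta>\<close>]) blast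
  have "\<exists>V d. open V \<and> U i \<subseteq> V \<and> 0 < d \<and> (\<forall>x\<in>V. \<forall>y\<in>V. dist x y \<le> d) \<and>
      d powr s \<le> hd_gauge s (U i) + \<eta> * (1 / 2) ^ i" for i
    by (rule open_enlargement[OF U(2) \<open>0 < s\<close>, of "\<eta> * (1 / 2) ^ i" i]) (use \<open>0 < \<eta>\<close> in \<open>simp, blast\<close>)
  then obtain V d where V: "\<And>i. open (V i)" "\<And>i. U i \<subseteq> V i" "\<And>i. 0 < d i"
    "\<And>i x y. x \<in> V i \<Longrightarrow> y \<in> V i \<Longrightarrow> dist x y \<le> d i"
    "\<And>i. d i powr s \<le> hd_gauge s (U i) + \<eta> * (1 / 2) ^ i"
    by metis
  have "(\<Sum>i. ennreal (d i powr s)) \<le> (\<Sum>i. ennreal (hd_gauge s (U i)) + ennreal (\<eta> * (1 / 2) ^ i))"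
    using V(5) \<open>0 < \<eta>\<close> by (intro suminf_le) (auto simp flip: ennreal_plus intro: ennreal_leI)
  also have "\<dots> = (\<Sum>i. ennreal (hd_gauge s (U i))) + (\<Sum>i. ennreal (\<eta> * (1 / 2) ^ i))"
    by (rule suminf_add[symmetric]) auto
  also have "(\<Sum>i. ennreal (\<eta> * (1 / 2) ^ i)) = ennreal (2 * \<eta>)"
  proof -
    have "(\<lambda>i. \<eta> * (1 / 2) ^ i) sums (\<eta> * (1 / (1 - 1 / 2)))"
      by (intro sums_mult geometric_sums) simp
    then show ?thesis
      using \<open>0 < \<eta>\<close> by (subst suminf_ennreal_eq[where x = "2 * \<eta>"]) (auto simp: mult.commute)
  qed
  also have "(\<Sum>i. ennreal (hd_gauge s (U i))) + ennreal (2 * \<eta>) \<le> ennreal \<eta> + ennreal (2 * \<eta>)"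
    using U(4) by (intro add_right_mono) simp
  also have "\<dots> = ennreal (3 * \<eta>)"
    using \<open>0 < \<eta>\<close> by (simp flip: ennreal_plus)
  also have "\<dots> < ennreal (4 * \<eta>)"
    using \<open>0 < \<eta>\<close> by (intro ennreal_lessI) auto
  finally have small: "(\<Sum>i. ennreal (d i powr s)) < ennreal (m\<^sup>2 * c / (4 * L))"
    by (simp add: \<eta>_def mult.commute)
  have "\<exists>n. level (1 / (real n + 2)) \<omega> \<subseteq> (\<Union>i. V i)"
  proof (rule compact_decseq_subset_open[of "\<lambda>n. level (1 / (real n + 2)) \<omega>" "\<Union>i. V i"])
    show "(\<Inter>n. level (1 / (real n + 2)) \<omega>) \<subseteq> (\<Union>i. V i)"
      using U(1) V(2) unfolding cutout_set_eq_Inter_level[symmetric] by blast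
    show "level (1 / (real n + 2)) \<omega> \<subseteq> level (1 / (real m + 2)) \<omega>" if "m \<le> n" for m n
      using that by (intro level_mono divide_left_mono) auto
  qed (use V(1) in \<open>auto intro: compact_level\<close>)
  then obtain n0 :: nat where n0: "level (1 / (real n0 + 2)) \<omega> \<subseteq> (\<Union>i. V i)"
    by blast
  obtain n where n: "n0 \<le> n" and mass: "ennreal m \<le> (\<integral>\<^sup>+x. level_density (1 / (n + 2)) \<omega> x \<partial>lborel)"
    and energy: "(\<integral>\<^sup>+x. \<integral>\<^sup>+y. level_density (1 / (n + 2)) \<omega> x * (level_density (1 / (n + 2)) \<omega> y * k x y) \<partial>lborel \<partial>lborel)
        \<le> ennreal L"
    using inf[of n0] by blast
  define e where "e = 1 / (real n + 2)"
  have "0 < e" by (simp add: e_def)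
  have e_le: "e \<le> 1 / (real n0 + 2)" using n by (simp add: e_def divide_left_mono)
  have [measurable]: "level_density e \<omega> \<in> borel_measurable borel"
    using borel_measurable_level_density[OF \<open>0 < e\<close>, of "\<lambda>_. \<omega>" borel "\<lambda>x. x"] \<omega> by simp
  define \<mu> where "\<mu> = density lborel (level_density e \<omega>)"
  have [simp, measurable_cong]: "sets \<mu> = sets borel" by (simp add: \<mu>_def)
  have "ennreal (m\<^sup>2 * c / (4 * L)) \<le> (\<Sum>i. ennreal (d i powr s))"
  proof (rule energy_cover_bound[where \<mu> = \<mu> and k = k and V = V])
    show "sets \<mu> = sets borel" by simp
    show "sigma_finite_measure \<mu>"
      unfolding \<mu>_def
      by (rule sigma_finite_measure.sigma_finite_iff_density_finite'[OF sigma_finite_lborel, THEN iffD2])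
        (auto simp: level_density_def indicator_def)
    show "ennreal m \<le> emeasure \<mu> UNIV"
    proof -
      have "emeasure \<mu> UNIV = (\<integral>\<^sup>+x. level_density e \<omega> x \<partial>lborel)"
        unfolding \<mu>_def by (subst emeasure_density) simp_all
      with mass show ?thesis by (simp add: e_def)
    qed
    show "(\<integral>\<^sup>+x. \<integral>\<^sup>+y. k x y \<partial>\<mu> \<partial>\<mu>) \<le> ennreal L"
    proof -
      have [measurable]: "k x \<in> borel_measurable borel" for x by measurable
      have inner: "(\<integral>\<^sup>+y. k x y \<partial>\<mu>) = (\<integral>\<^sup>+y. level_density e \<omega> y * k x y \<partial>lborel)" for x
        unfolding \<mu>_def by (rule nn_integral_density) measurable
      have "(\<integral>\<^sup>+x. \<integral>\<^sup>+y. k x y \<partial>\<mu> \<partial>\<mu>)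
          = (\<integral>\<^sup>+x. level_density e \<omega> x * (\<integral>\<^sup>+y. level_density e \<omega> y * k x y \<partial>lborel) \<partial>lborel)"
        unfolding inner unfolding \<mu>_def by (rule nn_integral_density) measurable
      also have "\<dots> = (\<integral>\<^sup>+x. \<integral>\<^sup>+y. level_density e \<omega> x * (level_density e \<omega> y * k x y) \<partial>lborel \<partial>lborel)"
        by (intro nn_integral_cong nn_integral_cmult[symmetric]) measurable
      finally show ?thesis using energy by (simp add: e_def)
    qed
    show "V i \<in> sets borel" for i using V(1) by simp
    show "AE x in \<mu>. x \<in> (\<Union>i. V i)"
      unfolding \<mu>_def
    proof (subst AE_density)
      have "level e \<omega> \<subseteq> (\<Union>i. V i)"
        using level_mono[OF e_le] n0 by blast
      then show "AE x in lborel. 0 < level_density e \<omega> x \<longrightarrow> x \<in> (\<Union>i. V i)"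
        by (intro AE_I2) (auto simp: level_density_def indicator_def split: if_splits)
    qed measurable
  qed (use pos V ck in auto)
  with small show False by simp
qed

end

text \<open>Here X is a mass and Y its energy. A small energy bounds the mass outright; at large
  energy the mass is charged to the energy, as sqrt(Y) is at most Y/r once Y is at least
  r^2.\<close>

lemma ennreal_le_of_square_le:
  fixes X Y :: ennreal
  assumes "X * X \<le> Y" "0 < r"
  shows "Y \<le> ennreal (r\<^sup>2) \<Longrightarrow> X \<le> ennreal r"
    and "ennreal (r\<^sup>2) \<le> Y \<Longrightarrow> X \<le> ennreal (1 / r) * Y"
proof -
  assume "Y \<le> ennreal (r\<^sup>2)"
  then have *: "X * X \<le> ennreal (r\<^sup>2)" using assms(1) by (rule order_trans[rotated])
  show "X \<le> ennreal r"
  proof (cases X)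
    case (real x)
    then have "x\<^sup>2 \<le> r\<^sup>2"
      using * by (simp add: ennreal_mult[symmetric] power2_eq_square)
    then have "x \<le> r" by (rule power2_le_imp_le) (use assms(2) in simp)
    then show ?thesis using real by (simp add: ennreal_leI)
  next
    case top
    then have "X * X = \<top>" by (simp add: ennreal_mult_eq_top_iff)
    with * show ?thesis by (metis ennreal_neq_top top_unique)
  qed
next
  assume Y: "ennreal (r\<^sup>2) \<le> Y"
  show "X \<le> ennreal (1 / r) * Y"
  proof (cases Y)
    case (real y)
    have "X * X \<noteq> \<top>" using assms(1) real(2) by (metis ennreal_neq_top top_unique)
    then have "X \<noteq> \<top>" by (auto simp: ennreal_mult_eq_top_iff)
    then obtain x where x: "X = ennreal x" "0 \<le> x" by (cases X) auto
    have "x * x \<le> y" "r * r \<le> y"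
      using assms(1) Y real x by (simp_all add: ennreal_mult[symmetric] power2_eq_square)
    have "x * r \<le> y"
    proof (cases "x \<le> r")
      case True
      then have "x * r \<le> r * r" using assms(2) by (intro mult_right_mono) auto
      with \<open>r * r \<le> y\<close> show ?thesis by linarith
    next
      case False
      then have "x * r \<le> x * x" using x by (intro mult_left_mono) auto
      with \<open>x * x \<le> y\<close> show ?thesis by linarith
    qed
    then show ?thesis
      using real x assms(2) by (simp add: ennreal_mult'[symmetric] field_simps ennreal_leI)
  next
    case top
    then show ?thesis using assms(2) by (simp add: ennreal_mult_top)
  qed
qed

text \<open>The tail unions decrease and each contains an event of probability at least p;
  continuity from above passes the bound to their intersection.\<close>

lemma (in prob_space) limsup_events_prob_ge:
  assumes A [measurable]: "\<And>n. A n \<in> events" and p: "\<And>n. p \<le> prob (A n)"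
  shows "(\<Inter>n::nat. \<Union>k\<in>{n..}. A k) \<in> events" "p \<le> prob (\<Inter>n. \<Union>k\<in>{n..}. A k)"
proof -
  let ?B = "\<lambda>n. \<Union>k\<in>{n..}. A k"
  have B: "?B n \<in> events" for n by measurable
  show "(\<Inter>n. ?B n) \<in> events" by measurable
  have "(\<lambda>n. prob (?B n)) \<longlonglongrightarrow> prob (\<Inter>n. ?B n)"
    using B by (intro finite_Lim_measure_decseq) (auto simp: decseq_def intro: order_trans)
  moreover have "p \<le> prob (?B n)" for n
    by (rule order_trans[OF p[of n]], rule finite_measure_mono[OF _ B]) auto
  ultimately show "p \<le> prob (\<Inter>n. ?B n)"
    by (intro LIMSEQ_le_const) auto
qed

text \<open>A weighted sum of Riesz kernels controls all exponents below the critical one at once.\<close>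
lemma critical_kernel:
  fixes \<gamma> :: real
  assumes "0 < \<gamma>" "\<gamma> < 4" and "\<And>j::nat. 0 \<le> s j" "\<And>j. s j < min (4 - \<gamma>) (3 - \<gamma> / 2)" "s 0 = 0"
  obtains k :: "complex \<times> real \<Rightarrow> complex \<times> real \<Rightarrow> ennreal" and c :: "nat \<Rightarrow> real" and J :: real
  where "case_prod k \<in> borel_measurable (borel \<Otimes>\<^sub>M borel)"
    "\<And>x y. 1 \<le> k x y" "\<And>j. 0 < c j" "\<And>j x y. ennreal (c j) * riesz (s j) x y \<le> k x y" "0 \<le> J"
    "\<And>x. x \<in> koranyi_cball (0, 0) 1 \<Longrightarrow>
      (\<integral>\<^sup>+y. indicator (koranyi_cball (0, 0) 1) y * (ennreal (koranyi_dist x y powr - \<gamma>) * k x y) \<partial>lborel)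
        \<le> ennreal J"
proof -
  let ?\<Omega> = "koranyi_cball (0::complex, 0::real) 1"
  have [measurable]: "?\<Omega> \<in> sets borel" by (intro borel_closed) simp
  have "\<exists>J. 0 \<le> J \<and> (\<forall>x\<in>?\<Omega>.
      (\<integral>\<^sup>+y. indicator ?\<Omega> y * (ennreal (koranyi_dist x y powr - \<gamma>) * riesz (s j) x y) \<partial>lborel) \<le> ennreal J)" for j
    by (rule nn_integral_kernel_bound[OF assms(1,2) assms(3,4)[of j]]) blast
  then obtain J where "\<forall>j. 0 \<le> J j \<and> (\<forall>x\<in>?\<Omega>.
      (\<integral>\<^sup>+y. indicator ?\<Omega> y * (ennreal (koranyi_dist x y powr - \<gamma>) * riesz (s j) x y) \<partial>lborel) \<le> ennreal (J j))"
    by (rule choice[OF allI, elim_format]) (elim exE)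
  then have J: "\<And>j. 0 \<le> J j" "\<And>j x. x \<in> ?\<Omega> \<Longrightarrow>
      (\<integral>\<^sup>+y. indicator ?\<Omega> y * (ennreal (koranyi_dist x y powr - \<gamma>) * riesz (s j) x y) \<partial>lborel) \<le> ennreal (J j)"
    by simp_all
  \<comment> \<open>The division by \<open>1 + J j\<close> absorbs the j-th energy bound and
    \<open>(1 / 2) ^ j\<close> makes the sum converge. The factor \<open>1 + J 0\<close> normalizes
    \<open>c 0\<close> to 1, so the term with exponent \<open>s 0 = 0\<close> alone gives
    \<open>1 \<le> k x y\<close>.\<close>
  define c where "c j = (1 + J 0) * (1 / 2) ^ j / (1 + J j)" for j
  have c: "0 < c j" for j
    using J(1)[of 0] J(1)[of j] by (simp add: c_def)
  define k where "k x y = (\<Sum>j. ennreal (c j) * riesz (s j) x y)" for x y :: "complex \<times> real"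
  have ck: "ennreal (c j) * riesz (s j) x y \<le> k x y" for j x y
    unfolding k_def using sum_le_suminf[of "\<lambda>j. ennreal (c j) * riesz (s j) x y" "{j}"] by simp
  have "c 0 = 1" using J(1)[of 0] by (simp add: c_def)
  then have "1 \<le> ennreal (c 0) * riesz (s 0) x y" for x y :: "complex \<times> real"
    using riesz_0_ge[of x y] assms(5) by simp
  then have k1: "1 \<le> k x y" for x y
    using ck order_trans by blast
  have km: "case_prod k \<in> borel_measurable (borel \<Otimes>\<^sub>M borel)"
    unfolding k_def by measurable
  have bound: "(\<integral>\<^sup>+y. indicator ?\<Omega> y * (ennreal (koranyi_dist x y powr - \<gamma>) * k x y) \<partial>lborel)
      \<le> ennreal (2 * (1 + J 0))" if x: "x \<in> ?\<Omega>" for x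
  proof -
    let ?f = "\<lambda>j y. indicator ?\<Omega> y * (ennreal (koranyi_dist x y powr - \<gamma>) * riesz (s j) x y)"
    have [measurable]: "?f j \<in> borel_measurable borel" for j
      by measurable
    have "(\<integral>\<^sup>+y. indicator ?\<Omega> y * (ennreal (koranyi_dist x y powr - \<gamma>) * k x y) \<partial>lborel)
        = (\<integral>\<^sup>+y. (\<Sum>j. ennreal (c j) * ?f j y) \<partial>lborel)"
      unfolding k_def ennreal_suminf_cmult[symmetric] by (simp only: mult_ac)
    also have "\<dots> = (\<Sum>j. \<integral>\<^sup>+y. ennreal (c j) * ?f j y \<partial>lborel)"
      by (rule nn_integral_suminf) measurable
    also have "\<dots> = (\<Sum>j. ennreal (c j) * (\<integral>\<^sup>+y. ?f j y \<partial>lborel))"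
      by (intro suminf_cong nn_integral_cmult) measurable
    also have "\<dots> \<le> (\<Sum>j. ennreal ((1 + J 0) * (1 / 2) ^ j))"
    proof (intro suminf_le)
      fix j
      have "ennreal (c j) * (\<integral>\<^sup>+y. ?f j y \<partial>lborel) \<le> ennreal (c j) * ennreal (J j)"
        by (intro mult_left_mono J(2) x) simp
      also have "\<dots> = ennreal (c j * J j)"
        using J(1)[of j] by (simp add: ennreal_mult'')
      also have "c j * J j = (1 + J 0) * (1 / 2) ^ j * (J j / (1 + J j))"
        by (simp add: c_def)
      also have "\<dots> \<le> (1 + J 0) * (1 / 2) ^ j * 1"
        using J(1)[of j] J(1)[of 0] by (intro mult_left_mono) auto
      finally show "ennreal (c j) * (\<integral>\<^sup>+y. ?f j y \<partial>lborel) \<le> ennreal ((1 + J 0) * (1 / 2) ^ j)"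
        by (simp add: ennreal_leI order_trans)
    qed auto
    also have "\<dots> = ennreal (2 * (1 + J 0))"
    proof -
      have "(\<lambda>j. (1 + J 0) * (1 / 2) ^ j) sums ((1 + J 0) * (1 / (1 - 1 / 2)))"
        by (intro sums_mult geometric_sums) simp
      then show ?thesis
        using J(1)[of 0] by (subst suminf_ennreal_eq[where x = "2 * (1 + J 0)"]) (auto simp: mult.commute)
    qed
    finally show ?thesis .
  qed
  show thesis
    using J(1)[of 0] by (intro that[of k c "2 * (1 + J 0)"] km k1 c ck bound) auto
qed

section \<open>First and second moments of the level measures\<close>

context poisson_cutout
begin

lemma sets_unit_cball [measurable]: "koranyi_cball (0::complex, 0::real) 1 \<in> sets borel"
  by (intro borel_closed) simp

lemma nn_integral_level_mass:
  assumes "0 < e" "e < 1"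
  shows "(\<integral>\<^sup>+\<omega>. \<integral>\<^sup>+x. level_density e \<omega> x \<partial>lborel \<partial>M) = emeasure lborel (koranyi_cball (0::complex, 0::real) 1)"
proof -
  interpret P: pair_sigma_finite M lborel ..
  let ?\<Omega> = "koranyi_cball (0::complex, 0::real) 1"
  note [measurable] = borel_measurable_level_density[OF assms(1)]
  note [measurable] = borel_measurable_indicator_level[OF assms(1)]
  have "(\<integral>\<^sup>+\<omega>. \<integral>\<^sup>+x. level_density e \<omega> x \<partial>lborel \<partial>M) = (\<integral>\<^sup>+x. \<integral>\<^sup>+\<omega>. level_density e \<omega> x \<partial>M \<partial>lborel)"
    by (rule P.Fubini'[symmetric]) measurable
  also have "\<dots> = (\<integral>\<^sup>+x. indicator ?\<Omega> x \<partial>lborel)"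
  proof (intro nn_integral_cong)
    fix x
    show "(\<integral>\<^sup>+\<omega>. level_density e \<omega> x \<partial>M) = indicator ?\<Omega> x"
    proof (cases "x \<in> ?\<Omega>")
      case True
      have "(\<integral>\<^sup>+\<omega>. level_density e \<omega> x \<partial>M) = ennreal (e powr - \<gamma>) * (\<integral>\<^sup>+\<omega>. indicator (level e \<omega>) x \<partial>M)"
        unfolding level_density_def by (rule nn_integral_cmult) measurable
      also have "\<dots> = ennreal (e powr - \<gamma> * e powr \<gamma>)"
        using assms True by (simp add: emeasure_mem_level ennreal_mult)
      also have "e powr - \<gamma> * e powr \<gamma> = 1"
        using assms by (simp add: powr_add[symmetric])
      finally show ?thesis using True by simp
    next
      case False
      then have "level_density e \<omega> x = 0" for \<omega>
        by (simp add: level_density_def indicator_def mem_level_iff)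
      with False show ?thesis by simp
    qed
  qed
  finally show ?thesis by simp
qed

text \<open>The normalization cancels the powers of e in the two-point estimate. What remains is a
  deterministic kernel integral, bounded uniformly in e.\<close>

lemma nn_integral_level_energy_le:
  assumes e: "0 < e" "e < 1"
    and k [measurable]: "case_prod k \<in> borel_measurable (borel \<Otimes>\<^sub>M borel)"
    and J: "0 \<le> J" "\<And>x. x \<in> koranyi_cball (0, 0) 1 \<Longrightarrow>
      (\<integral>\<^sup>+y. indicator (koranyi_cball (0, 0) 1) y * (ennreal (koranyi_dist x y powr - \<gamma>) * k x y) \<partial>lborel)
        \<le> ennreal J"
  shows "(\<integral>\<^sup>+\<omega>. \<integral>\<^sup>+x. \<integral>\<^sup>+y. level_density e \<omega> x * (level_density e \<omega> y * k x y) \<partial>lborel \<partial>lborel \<partial>M)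
    \<le> ennreal (2 powr \<gamma> * J) * emeasure lborel (koranyi_cball (0::complex, 0::real) 1)"
proof -
  interpret P: pair_sigma_finite M lborel ..
  let ?\<Omega> = "koranyi_cball (0::complex, 0::real) 1" and ?l = "level_density e"
  note [measurable] = borel_measurable_level_density[OF assms(1)]
  note [measurable] = borel_measurable_indicator_level[OF assms(1)]
  have [measurable]: "(\<lambda>z. k (f z) (g z)) \<in> borel_measurable A"
    if [measurable]: "f \<in> borel_measurable A" "g \<in> borel_measurable A" for f g and A :: "'z measure"
    using measurable_compose[OF measurable_Pair[OF that] k] by simp
  have pair: "(\<integral>\<^sup>+\<omega>. ?l \<omega> x * ?l \<omega> y \<partial>M) \<le> indicator ?\<Omega> x * (indicator ?\<Omega> y * ennreal (2 powr \<gamma> * koranyi_dist x y powr - \<gamma>))"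
    if "x \<noteq> y" for x y
  proof (cases "x \<in> ?\<Omega> \<and> y \<in> ?\<Omega>")
    case True
    have d: "0 < koranyi_dist x y" using that by (rule koranyi_dist_pos)
    have "(\<integral>\<^sup>+\<omega>. ?l \<omega> x * ?l \<omega> y \<partial>M)
        = (\<integral>\<^sup>+\<omega>. ennreal ((e powr - \<gamma>)\<^sup>2) * (indicator (level e \<omega>) x * indicator (level e \<omega>) y) \<partial>M)"
      by (simp add: level_density_def power2_eq_square ennreal_mult mult_ac)
    also have "\<dots> = ennreal ((e powr - \<gamma>)\<^sup>2) * (\<integral>\<^sup>+\<omega>. indicator (level e \<omega>) x * indicator (level e \<omega>) y \<partial>M)"
      by (rule nn_integral_cmult) measurable
    also have "\<dots> \<le> ennreal ((e powr - \<gamma>)\<^sup>2) * ennreal ((e powr \<gamma>)\<^sup>2 * (2 / koranyi_dist x y) powr \<gamma>)"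
      using True that d by (intro mult_left_mono emeasure_pair_mem_level e) auto
    also have "\<dots> = ennreal ((e powr - \<gamma> * e powr \<gamma>)\<^sup>2 * (2 / koranyi_dist x y) powr \<gamma>)"
      by (simp add: ennreal_mult'[symmetric] power_mult_distrib mult.assoc)
    also have "(e powr - \<gamma> * e powr \<gamma>)\<^sup>2 * (2 / koranyi_dist x y) powr \<gamma> = 2 powr \<gamma> * koranyi_dist x y powr - \<gamma>"
      using e d by (simp add: powr_add[symmetric] powr_divide powr_minus_divide)
    finally show ?thesis using True by simp
  next
    case False
    then have "?l \<omega> x * ?l \<omega> y = 0" for \<omega>
      by (auto simp: level_density_def indicator_def mem_level_iff)
    then show ?thesis by (simp only: nn_integral_const mult_zero_left zero_le)
  qed
  have "(\<integral>\<^sup>+\<omega>. \<integral>\<^sup>+x. \<integral>\<^sup>+y. ?l \<omega> x * (?l \<omega> y * k x y) \<partial>lborel \<partial>lborel \<partial>M)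
      = (\<integral>\<^sup>+x. \<integral>\<^sup>+\<omega>. \<integral>\<^sup>+y. ?l \<omega> x * (?l \<omega> y * k x y) \<partial>lborel \<partial>M \<partial>lborel)"
    by (rule P.Fubini'[symmetric]) measurable
  also have "\<dots> = (\<integral>\<^sup>+x. \<integral>\<^sup>+y. \<integral>\<^sup>+\<omega>. ?l \<omega> x * (?l \<omega> y * k x y) \<partial>M \<partial>lborel \<partial>lborel)"
    by (intro nn_integral_cong P.Fubini'[symmetric]) measurable
  also have "\<dots> = (\<integral>\<^sup>+x. \<integral>\<^sup>+y. (\<integral>\<^sup>+\<omega>. ?l \<omega> x * ?l \<omega> y \<partial>M) * k x y \<partial>lborel \<partial>lborel)"
    unfolding mult.assoc[symmetric] by (intro nn_integral_cong nn_integral_multc) measurable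
  also have "\<dots> \<le> (\<integral>\<^sup>+x. ennreal (2 powr \<gamma>) * (indicator ?\<Omega> x *
      (\<integral>\<^sup>+y. indicator ?\<Omega> y * (ennreal (koranyi_dist x y powr - \<gamma>) * k x y) \<partial>lborel)) \<partial>lborel)"
  proof (intro nn_integral_mono)
    fix x
    have "(\<integral>\<^sup>+y. (\<integral>\<^sup>+\<omega>. ?l \<omega> x * ?l \<omega> y \<partial>M) * k x y \<partial>lborel)
        \<le> (\<integral>\<^sup>+y. (ennreal (2 powr \<gamma>) * indicator ?\<Omega> x) *
            (indicator ?\<Omega> y * (ennreal (koranyi_dist x y powr - \<gamma>) * k x y)) \<partial>lborel)"
    \<comment> \<open>The estimate \<open>pair\<close> excludes the diagonal, where
      \<open>0 powr - \<gamma>\<close> is 0; for fixed x this is a single point y.\<close>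
    proof (rule nn_integral_mono_AE, use AE_lborel_singleton[of x] in eventually_elim)
      case (elim y)
      then have "(\<integral>\<^sup>+\<omega>. ?l \<omega> x * ?l \<omega> y \<partial>M) * k x y
          \<le> indicator ?\<Omega> x * (indicator ?\<Omega> y * ennreal (2 powr \<gamma> * koranyi_dist x y powr - \<gamma>)) * k x y"
        by (intro mult_right_mono pair) auto
      then show ?case by (simp add: ennreal_mult mult_ac)
    qed
    also have "\<dots> = (ennreal (2 powr \<gamma>) * indicator ?\<Omega> x) *
        (\<integral>\<^sup>+y. indicator ?\<Omega> y * (ennreal (koranyi_dist x y powr - \<gamma>) * k x y) \<partial>lborel)"
      by (rule nn_integral_cmult) measurable
    finally show "(\<integral>\<^sup>+y. (\<integral>\<^sup>+\<omega>. ?l \<omega> x * ?l \<omega> y \<partial>M) * k x y \<partial>lborel)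
        \<le> ennreal (2 powr \<gamma>) * (indicator ?\<Omega> x *
          (\<integral>\<^sup>+y. indicator ?\<Omega> y * (ennreal (koranyi_dist x y powr - \<gamma>) * k x y) \<partial>lborel))"
      by (simp only: mult.assoc)
  qed
  also have "\<dots> \<le> (\<integral>\<^sup>+x. ennreal (2 powr \<gamma> * J) * indicator ?\<Omega> x \<partial>lborel)"
  proof (intro nn_integral_mono)
    fix x
    show "ennreal (2 powr \<gamma>) * (indicator ?\<Omega> x *
        (\<integral>\<^sup>+y. indicator ?\<Omega> y * (ennreal (koranyi_dist x y powr - \<gamma>) * k x y) \<partial>lborel))
      \<le> ennreal (2 powr \<gamma> * J) * indicator ?\<Omega> x"
    proof (cases "x \<in> ?\<Omega>")
      case True
      then show ?thesis using J(1) by (simp add: ennreal_mult mult_left_mono J(2))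
    qed simp
  qed
  also have "\<dots> = ennreal (2 powr \<gamma> * J) * emeasure lborel ?\<Omega>"
    by (simp add: nn_integral_cmult)
  finally show ?thesis .
qed

text \<open>Since the squared mass \<open>X\<^sup>2\<close> is at most the energy \<open>Y\<close>, one has \<open>X \<le> V/2 + r 1\<^sub>A + Y/r\<close> for the event
  \<open>A\<close> that \<open>X \<ge> V/2\<close> and \<open>Y \<le> r\<^sup>2\<close>; taking expectations bounds the probability of \<open>A\<close> from below.\<close>
lemma limsup_event:
  assumes k [measurable]: "case_prod k \<in> borel_measurable (borel \<Otimes>\<^sub>M borel)" and k1: "\<And>x y. 1 \<le> k x y"
    and J: "0 \<le> J" "\<And>x. x \<in> koranyi_cball (0, 0) 1 \<Longrightarrow>
      (\<integral>\<^sup>+y. indicator (koranyi_cball (0, 0) 1) y * (ennreal (koranyi_dist x y powr - \<gamma>) * k x y) \<partial>lborel)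
        \<le> ennreal J"
  obtains A m L where "A \<in> events" "0 < prob A" "0 < m" "0 < L"
    "\<forall>\<omega>\<in>A. \<forall>n0. \<exists>n\<ge>n0::nat. ennreal m \<le> (\<integral>\<^sup>+x. level_density (1 / (n + 2)) \<omega> x \<partial>lborel) \<and>
      (\<integral>\<^sup>+x. \<integral>\<^sup>+y. level_density (1 / (n + 2)) \<omega> x * (level_density (1 / (n + 2)) \<omega> y * k x y) \<partial>lborel \<partial>lborel)
        \<le> ennreal L"
proof -
  let ?\<Omega> = "koranyi_cball (0::complex, 0::real) 1" and ?e = "\<lambda>n::nat. 1 / (real n + 2)"
  have e: "0 < ?e n" "?e n < 1" for n by simp_all
  note [measurable] = borel_measurable_level_density[OF e(1)]
  have [measurable]: "(\<lambda>z. k (f z) (g z)) \<in> borel_measurable A"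
    if [measurable]: "f \<in> borel_measurable A" "g \<in> borel_measurable A" for f g and A :: "'z measure"
    using measurable_compose[OF measurable_Pair[OF that] k] by simp
  define V where "V = measure lborel ?\<Omega>"
  have "emeasure lborel ?\<Omega> < \<infinity>"
    by (intro emeasure_bounded_finite compact_imp_bounded compact_koranyi_unit_cball)
  then have V: "emeasure lborel ?\<Omega> = ennreal V"
    unfolding V_def by (intro emeasure_eq_ennreal_measure) auto
  have "0 < emeasure lborel ?\<Omega>"
    using emeasure_koranyi_unit_ball(1) emeasure_mono[OF koranyi_ball_subset_cball, of "(0, 0)" 1 lborel]
      sets_unit_cball by (metis order_less_le_trans sets_lborel)
  then have "0 < V" unfolding V by simp
  define X where "X n \<omega> = (\<integral>\<^sup>+x. level_density (?e n) \<omega> x \<partial>lborel)" for n \<omega>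
  define Y where "Y n \<omega> = (\<integral>\<^sup>+x. \<integral>\<^sup>+y. level_density (?e n) \<omega> x * (level_density (?e n) \<omega> y * k x y)
    \<partial>lborel \<partial>lborel)" for n \<omega>
  have X [measurable]: "X n \<in> borel_measurable M" for n unfolding X_def by measurable
  have Y [measurable]: "Y n \<in> borel_measurable M" for n unfolding Y_def by measurable
  \<comment> \<open>The squared mass is the energy of the constant kernel 1, which k
    dominates.\<close>
  have XY: "X n \<omega> * X n \<omega> \<le> Y n \<omega>" if [measurable]: "\<omega> \<in> space M" for n \<omega>
  proof -
    have [measurable]: "level_density (?e n) \<omega> \<in> borel_measurable borel"
      using borel_measurable_level_density[OF e(1), of "\<lambda>_. \<omega>" borel "\<lambda>x. x" n] that by simp
    have "X n \<omega> * X n \<omega> = (\<integral>\<^sup>+x. \<integral>\<^sup>+y. level_density (?e n) \<omega> x * level_density (?e n) \<omega> y \<partial>lborel \<partial>lborel)"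
      unfolding X_def by (simp add: nn_integral_cmult nn_integral_multc)
    also have "\<dots> \<le> Y n \<omega>"
      unfolding Y_def
    proof (intro nn_integral_mono)
      fix x y
      have "level_density (?e n) \<omega> y * 1 \<le> level_density (?e n) \<omega> y * k x y"
        by (intro mult_left_mono k1) simp
      then show "level_density (?e n) \<omega> x * level_density (?e n) \<omega> y
          \<le> level_density (?e n) \<omega> x * (level_density (?e n) \<omega> y * k x y)"
        by (intro mult_left_mono) simp_all
    qed
    finally show ?thesis .
  qed
  have EX: "(\<integral>\<^sup>+\<omega>. X n \<omega> \<partial>M) = ennreal V" for n
    unfolding X_def V[symmetric] by (rule nn_integral_level_mass[OF e])
  define J' where "J' = 2 powr \<gamma> * J * V"
  have "0 \<le> J'" using J(1) \<open>0 < V\<close> by (simp add: J'_def)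
  have EY: "(\<integral>\<^sup>+\<omega>. Y n \<omega> \<partial>M) \<le> ennreal J'" for n
    using nn_integral_level_energy_le[OF e k J, of n] J(1) \<open>0 < V\<close>
    unfolding Y_def V by (simp add: J'_def ennreal_mult)
  \<comment> \<open>Chosen so that the energy term J'/r is at most V/4. Then V is at most V/2 + V/4
    plus r times the probability of \<open>A n\<close>, which leaves V/(4r); the summand 1 keeps r
    positive when J' = 0.\<close>
  define r where "r = (4 * J' + 1) / V"
  have "0 < r" using \<open>0 \<le> J'\<close> \<open>0 < V\<close> by (simp add: r_def)
  have "J' / r \<le> V / 4"
    using \<open>0 \<le> J'\<close> \<open>0 < V\<close> by (simp add: r_def field_simps)
  define A where "A n = {\<omega> \<in> space M. ennreal (V / 2) \<le> X n \<omega> \<and> Y n \<omega> \<le> ennreal (r\<^sup>2)}" for n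
  have A [measurable]: "A n \<in> events" for n unfolding A_def by measurable
  have prob_A: "V / (4 * r) \<le> prob (A n)" for n
  proof -
    have "ennreal V = (\<integral>\<^sup>+\<omega>. X n \<omega> \<partial>M)" by (simp add: EX)
    also have "\<dots> \<le> (\<integral>\<^sup>+\<omega>. ennreal (V / 2) + (ennreal r * indicator (A n) \<omega> + ennreal (1 / r) * Y n \<omega>) \<partial>M)"
    proof (intro nn_integral_mono)
      fix \<omega> assume \<omega>: "\<omega> \<in> space M"
      consider "X n \<omega> \<le> ennreal (V / 2)" | "ennreal (r\<^sup>2) \<le> Y n \<omega>" | "\<omega> \<in> A n"
        using \<omega> unfolding A_def by (auto simp: not_le) (meson linear)
      then show "X n \<omega> \<le> ennreal (V / 2) + (ennreal r * indicator (A n) \<omega> + ennreal (1 / r) * Y n \<omega>)"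
      proof cases
        case 1
        then show ?thesis by (simp add: add_increasing2)
      next
        case 2
        then have "X n \<omega> \<le> ennreal (1 / r) * Y n \<omega>"
          using ennreal_le_of_square_le(2)[OF XY[OF \<omega>] \<open>0 < r\<close>] by blast
        then show ?thesis by (intro add_increasing) auto
      next
        case 3
        then have "X n \<omega> \<le> ennreal r"
          using ennreal_le_of_square_le(1)[OF XY[OF \<omega>] \<open>0 < r\<close>] by (simp add: A_def)
        then have "X n \<omega> \<le> ennreal r * indicator (A n) \<omega>" using 3 by simp
        then show ?thesis by (intro add_increasing add_increasing2) auto
      qed
    qed
    also have "\<dots> = ennreal (V / 2) + (ennreal r * ennreal (prob (A n)) + ennreal (1 / r) * (\<integral>\<^sup>+\<omega>. Y n \<omega> \<partial>M))"
      by (simp add: nn_integral_add nn_integral_cmult emeasure_eq_measure prob_space)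
    also have "\<dots> \<le> ennreal (V / 2) + (ennreal r * ennreal (prob (A n)) + ennreal (1 / r) * ennreal J')"
      by (intro add_left_mono mult_left_mono EY) simp
    also have "\<dots> = ennreal (V / 2 + (r * prob (A n) + J' / r))"
      using \<open>0 < r\<close> \<open>0 < V\<close> \<open>0 \<le> J'\<close> by (simp add: ennreal_mult'[symmetric] flip: ennreal_plus)
    finally have "V \<le> V / 2 + (r * prob (A n) + J' / r)"
      using \<open>0 < r\<close> \<open>0 < V\<close> \<open>0 \<le> J'\<close> by (subst (asm) ennreal_le_iff) auto
    with \<open>J' / r \<le> V / 4\<close> have "V / 4 \<le> r * prob (A n)" by linarith
    then show ?thesis using \<open>0 < r\<close> by (simp add: field_simps)
  qed
  have "0 < V / (4 * r)" using \<open>0 < V\<close> \<open>0 < r\<close> by simp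
  then have "0 < prob (\<Inter>n. \<Union>k\<in>{n..}. A k)"
    using limsup_events_prob_ge(2)[of A, OF A prob_A] by linarith
  then show thesis
  proof (rule that[OF limsup_events_prob_ge(1)[of A, OF A prob_A]])
    show "0 < V / 2" "0 < r\<^sup>2" using \<open>0 < V\<close> \<open>0 < r\<close> by simp_all
    have "\<exists>n\<ge>n0. \<omega> \<in> A n" if "\<omega> \<in> (\<Inter>n. \<Union>k\<in>{n..}. A k)" for \<omega> n0
      using that by blast
    then show "\<forall>\<omega>\<in>(\<Inter>n. \<Union>k\<in>{n..}. A k). \<forall>n0. \<exists>n\<ge>n0. ennreal (V / 2) \<le> (\<integral>\<^sup>+x. level_density (?e n) \<omega> x \<partial>lborel) \<and>
      (\<integral>\<^sup>+x. \<integral>\<^sup>+y. level_density (?e n) \<omega> x * (level_density (?e n) \<omega> y * k x y) \<partial>lborel \<partial>lborel)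
        \<le> ennreal (r\<^sup>2)"
      unfolding A_def X_def Y_def by simp
  qed
qed

text \<open>Since one kernel serves all the exponents \<open>s j\<close>, the single event
  \<open>A\<close> excludes null measure for every positive \<open>s j\<close> at once, and these
  increase to the critical value. Removing the null set of the upper bound gives equality.\<close>

lemma hausdorff_dim_cutout_positive_prob:
  assumes "\<gamma> < 4"
  shows "\<exists>A\<in>events. 0 < prob A \<and>
    (\<forall>\<omega>\<in>A. hausdorff_dim (cutout_set (N \<omega>)) = min (4 - \<gamma>) (3 - \<gamma> / 2))"
proof -
  let ?\<alpha> = "min (4 - \<gamma>) (3 - \<gamma> / 2)"
  have "0 < ?\<alpha>" using assms by simp
  define s where "s j = ?\<alpha> * (1 - 1 / (real j + 1))" for j :: nat
  have s: "0 \<le> s j" "s j < ?\<alpha>" for j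
  proof -
    have "0 \<le> 1 - 1 / (real j + 1)" "1 - 1 / (real j + 1) < 1" by simp_all
    then show "0 \<le> s j" "s j < ?\<alpha>"
      using \<open>0 < ?\<alpha>\<close> mult_strict_left_mono[of "1 - 1 / (real j + 1)" 1 ?\<alpha>]
      unfolding s_def by (simp_all only: mult_nonneg_nonneg less_imp_le mult_1_right)
  qed
  have "s 0 = 0" by (simp add: s_def)
  obtain k c J where k: "case_prod k \<in> borel_measurable (borel \<Otimes>\<^sub>M borel)"
    "\<And>x y. 1 \<le> k x y" "\<And>j. 0 < c j" "\<And>j x y. ennreal (c j) * riesz (s j) x y \<le> k x y" "0 \<le> J"
    "\<And>x. x \<in> koranyi_cball (0, 0) 1 \<Longrightarrow>
      (\<integral>\<^sup>+y. indicator (koranyi_cball (0, 0) 1) y * (ennreal (koranyi_dist x y powr - \<gamma>) * k x y) \<partial>lborel)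
        \<le> ennreal J"
    by (rule critical_kernel[where s = s, OF gamma_pos assms s \<open>s 0 = 0\<close>]) blast
  obtain A m L where A: "A \<in> events" "0 < prob A" "0 < m" "0 < L"
    and inf: "\<forall>\<omega>\<in>A. \<forall>n0. \<exists>n\<ge>n0::nat. ennreal m \<le> (\<integral>\<^sup>+x. level_density (1 / (n + 2)) \<omega> x \<partial>lborel) \<and>
      (\<integral>\<^sup>+x. \<integral>\<^sup>+y. level_density (1 / (n + 2)) \<omega> x * (level_density (1 / (n + 2)) \<omega> y * k x y) \<partial>lborel \<partial>lborel)
        \<le> ennreal L"
    by (rule limsup_event[OF k(1,2,5,6)])
  have lower: "?\<alpha> \<le> t" if \<omega>: "\<omega> \<in> A" and t: "0 \<le> t" "hausdorff_measure t (cutout_set (N \<omega>)) = 0" for \<omega> t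
  proof -
    have "s j \<le> t" if "0 < s j" for j
    proof (rule ccontr)
      assume "\<not> s j \<le> t"
      then have "hausdorff_measure (s j) (cutout_set (N \<omega>)) = 0"
        using t by (intro hausdorff_measure_eq_0_mono[OF t(2)]) auto
      moreover have "\<omega> \<in> space M" using \<omega> A(1) sets.sets_into_space by blast
      ultimately show False
        using hausdorff_measure_cutout_pos[OF _ k(1) k(4) k(3) that A(3,4) inf[rule_format, OF \<omega>]] by blast
    qed
    then have "s j \<le> t" for j using t(1) s(1)[of j] by (cases "s j = 0") auto
    moreover have "s \<longlonglongrightarrow> ?\<alpha> * (1 - 0)"
      unfolding s_def using LIMSEQ_Suc[OF lim_1_over_n]
      by (intro tendsto_intros) (simp add: add.commute)
    ultimately show ?thesis by (intro LIMSEQ_le_const2[of s]) auto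
  qed
  \<comment> \<open>The infimum of an empty set of reals carries no information. The exponent 5,
    safely above \<open>4 - \<gamma>\<close>, shows that the set in \<open>hausdorff_dim\<close> is
    nonempty, as \<open>cInf_greatest\<close> requires.\<close>
  have "AE \<omega> in M. hausdorff_measure 5 (cutout_set (N \<omega>)) = 0"
    using gamma_pos by (intro AE_hausdorff_measure_cutout_eq_0_cells[of 5 1]) auto
  with AE_hausdorff_dim_cutout_le[OF assms]
  have "AE \<omega> in M. hausdorff_dim (cutout_set (N \<omega>)) \<le> ?\<alpha> \<and> hausdorff_measure 5 (cutout_set (N \<omega>)) = 0"
    by eventually_elim simp
  then obtain Z where Z: "Z \<in> null_sets M" "\<And>\<omega>. \<omega> \<in> space M - Z \<Longrightarrow>
      hausdorff_dim (cutout_set (N \<omega>)) \<le> ?\<alpha> \<and> hausdorff_measure 5 (cutout_set (N \<omega>)) = 0"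
    by (rule AE_E3) blast
  show ?thesis
  proof (intro bexI conjI ballI)
    show "A - Z \<in> events" using A(1) Z(1) by auto
    have "prob (A - Z) = prob A" using A(1) Z(1) by (intro measure_Diff_null_set)
    then show "0 < prob (A - Z)" using A(2) by simp
    fix \<omega> assume \<omega>: "\<omega> \<in> A - Z"
    then have up: "hausdorff_dim (cutout_set (N \<omega>)) \<le> ?\<alpha>" and "hausdorff_measure 5 (cutout_set (N \<omega>)) = 0"
      using Z(2)[of \<omega>] A(1) sets.sets_into_space by auto
    then have "?\<alpha> \<le> hausdorff_dim (cutout_set (N \<omega>))"
      unfolding hausdorff_dim_def using lower[of \<omega>] \<omega>
      by (intro cInf_greatest) (auto intro!: exI[of _ 5])
    with up show "hausdorff_dim (cutout_set (N \<omega>)) = ?\<alpha>" by (rule antisym)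
  qed
qed

end

theorem theorem4p6:
  fixes \<gamma> :: real and M :: "'w measure" and N :: "'w \<Rightarrow> ((complex \<times> real) \<times> real) set"
  assumes "0 < \<gamma>" and "\<gamma> < 4"
    and "poisson_point_process M (cutout_intensity \<gamma>) N"
  shows "\<exists>A\<in>sets M. measure M A > 0 \<and>
           (\<forall>\<omega>\<in>A. hausdorff_dim (cutout_set (N \<omega>)) =
              (let \<beta> = 4 - \<gamma> in if \<beta> \<le> 2 then \<beta> else 2 + (\<beta> - 2) / 2))"
proof -
  have "prob_space M" using assms(3) by (simp add: poisson_point_process_def)
  then interpret poisson_cutout M N \<gamma>
    using assms by (intro poisson_cutout.intro poisson_cutout_axioms.intro)
  \<comment> \<open>The second branch equals \<open>3 - \<gamma> / 2\<close>, and
    \<open>4 - \<gamma>\<close> is the smaller entry exactly when \<open>\<gamma> \<ge> 2\<close>,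
    that is \<beta> at most 2.\<close>
  have "(let \<beta> = 4 - \<gamma> in if \<beta> \<le> 2 then \<beta> else 2 + (\<beta> - 2) / 2) = min (4 - \<gamma>) (3 - \<gamma> / 2)"
    by (simp add: Let_def min_def field_simps)
  then show ?thesis using hausdorff_dim_cutout_positive_prob[OF assms(2)] by simp
qed

end
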